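(* Let $R$ and $S$ be iTRSs over disjoint signatures and let $R+S$ be their disjoint union. If $R+S$ is convergent, then $R$ and $S$ are convergent; and if $R+S$ is strongly convergent, then $R$ and $S$ are strongly convergent.
   Context: An ultra-metric map (umm) of arity $n$ is $f:[0,1]^n\to[0,1]$ with $f(\vec x)=0$ iff all $x_i=0$ and distributing over componentwise $\max$. A term metric $m$ assigns each $n$-ary function symbol $F$ a continuous $n$-ary umm $F_m$; the distance $d_m$ on finite terms is $d_m(t,t)=0$, $1$ for different root symbols, and $d_m(F(\vec t),F(\vec u))=F_m(d_m(t_1,u_1),\dots,d_m(t_n,u_n))$; $\mathrm{Ter}_m$ is its metric completion. An iTRS $(\Sigma,m,R)$ has a signature, a term metric, and rules $l\to r$ in $\mathrm{Ter}_m$ with $l$ not a variable and variables of $r$ occurring in $l$; its rewrite relation is the closure under substitutions and contexts. A reduction sequence is a continuous $f:\alpha\to\mathrm{Ter}_m$ ($\alpha$ an ordinal, order topology) with $f(\beta)\to f(\beta+1)$ for $\beta+1<\alpha$; open if $\alpha$ is a limit; an open sequence converges if it extends continuously to $\alpha+1$. The iTRS is convergent if all open reduction sequences converge. The indirected version of $(\Sigma,m,R)$ adds a fresh unary symbol $I$ with $I_m(x)=x$, replaces each rule $l\to r$ by $l\to I(r)$, and adds the rule $I(x)\to x$; the iTRS is strongly convergent if its indirected version is convergent. The disjoint union $R+S$ of iTRSs with disjoint signatures has the union of signatures, the union of rules, and the term metric agreeing with each constituent's term metric on its symbols. *)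

theory Defs
  imports "HOL-Analysis.Analysis"
begin

section \<open>Ultra-metric maps\<close>

text \<open>Points of \<open>[0,1]\<^sup>n\<close> are functions \<open>nat \<Rightarrow> real\<close> on the index set \<open>{..<n}\<close>, extensional outside it,
  so that the library product topology applies for every \<open>n\<close>.\<close>

abbreviation cube :: "nat \<Rightarrow> (nat \<Rightarrow> real) set" where
  "cube n \<equiv> {..<n} \<rightarrow>\<^sub>E {0..1}"

definition umm :: "nat \<Rightarrow> ((nat \<Rightarrow> real) \<Rightarrow> real) \<Rightarrow> bool" where
  "umm n f \<longleftrightarrow>
     f \<in> cube n \<rightarrow> {0..1} \<and>
     (\<forall>x\<in>cube n. f x = 0 \<longleftrightarrow> (\<forall>i<n. x i = 0)) \<and>
     (\<forall>x\<in>cube n. \<forall>y\<in>cube n. f (\<lambda>i\<in>{..<n}. max (x i) (y i)) = max (f x) (f y))"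

definition continuous_umm :: "nat \<Rightarrow> ((nat \<Rightarrow> real) \<Rightarrow> real) \<Rightarrow> bool" where
  "continuous_umm n f \<longleftrightarrow>
     umm n f \<and>
     continuous_map (product_topology (\<lambda>_. top_of_set {0..1}) {..<n}) (top_of_set {0..1}) f"


section \<open>Finite terms and their distance\<close>

datatype ('f, 'v) fterm = Var 'v | Fun 'f "('f, 'v) fterm list"

record 'f msig =
  symbols :: "'f set"
  arity :: "'f \<Rightarrow> nat"
  umap :: "'f \<Rightarrow> (nat \<Rightarrow> real) \<Rightarrow> real"

definition term_metric :: "'f msig \<Rightarrow> bool" where
  "term_metric \<Sigma> \<longleftrightarrow> (\<forall>F\<in>symbols \<Sigma>. continuous_umm (arity \<Sigma> F) (umap \<Sigma> F))"

inductive_set fin_terms :: "'f msig \<Rightarrow> ('f, 'v) fterm set" for \<Sigma> :: "'f msig" where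
  Var: "Var x \<in> fin_terms \<Sigma>"
| Fun: "\<lbrakk>F \<in> symbols \<Sigma>; length ts = arity \<Sigma> F; \<forall>t\<in>set ts. t \<in> fin_terms \<Sigma>\<rbrakk>
        \<Longrightarrow> Fun F ts \<in> fin_terms \<Sigma>"

text \<open>Variables act as nullary symbols. The conditional expression is \<open>restrict\<close>, unfolded.\<close>

function (sequential) pre_dist ::
    "('f \<Rightarrow> (nat \<Rightarrow> real) \<Rightarrow> real) \<Rightarrow> ('f, 'v) fterm \<Rightarrow> ('f, 'v) fterm \<Rightarrow> real" where
  "pre_dist m (Var x) (Var y) = (if x = y then 0 else 1)"
| "pre_dist m (Fun F ts) (Fun G us) =
     (if F = G
      then m F (\<lambda>i. if i < length ts then pre_dist m (ts ! i) (us ! i) else undefined)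
      else 1)"
| "pre_dist m t u = 1"
  by pat_completeness auto
termination
  by (relation "Wellfounded.measure (\<lambda>(m, t, u). size t)")
     (auto simp: less_Suc_eq_le intro!: size_list_estimation'[OF nth_mem])

text \<open>The library's \<open>Metric_space\<close> asks for symmetry and nonnegativity on the whole type,
  hence the default value outside the carrier, here and for \<open>completion_dist\<close> below.\<close>

definition fin_dist :: "'f msig \<Rightarrow> ('f, 'v) fterm \<Rightarrow> ('f, 'v) fterm \<Rightarrow> real" where
  "fin_dist \<Sigma> t u =
     (if t \<in> fin_terms \<Sigma> \<and> u \<in> fin_terms \<Sigma> then pre_dist (umap \<Sigma>) t u else 0)"


section \<open>Metric completion\<close>

text \<open>Cauchy sequences modulo having distance tending to \<open>0\<close>.\<close>

definition cauchy_rel :: "'a set \<Rightarrow> ('a \<Rightarrow> 'a \<Rightarrow> real) \<Rightarrow> (nat \<Rightarrow> 'a) rel" where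
  "cauchy_rel M d =
     {(s, t). Metric_space.MCauchy M d s \<and> Metric_space.MCauchy M d t \<and>
              (\<lambda>n. d (s n) (t n)) \<longlonglongrightarrow> 0}"

definition completion :: "'a set \<Rightarrow> ('a \<Rightarrow> 'a \<Rightarrow> real) \<Rightarrow> (nat \<Rightarrow> 'a) set set" where
  "completion M d = {s. Metric_space.MCauchy M d s} // cauchy_rel M d"

definition completion_dist ::
    "'a set \<Rightarrow> ('a \<Rightarrow> 'a \<Rightarrow> real) \<Rightarrow> (nat \<Rightarrow> 'a) set \<Rightarrow> (nat \<Rightarrow> 'a) set \<Rightarrow> real" where
  "completion_dist M d A B =
     (if A \<in> completion M d \<and> B \<in> completion M d
      then THE r. \<forall>s\<in>A. \<forall>t\<in>B. (\<lambda>n. d (s n) (t n)) \<longlonglongrightarrow> r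
      else 0)"


section \<open>The space of terms\<close>

type_synonym ('f, 'v) ter = "(nat \<Rightarrow> ('f, 'v) fterm) set"

definition Ter :: "'f msig \<Rightarrow> ('f, 'v) ter set" where
  "Ter \<Sigma> = completion (fin_terms \<Sigma>) (fin_dist \<Sigma>)"

definition ter_dist :: "'f msig \<Rightarrow> ('f, 'v) ter \<Rightarrow> ('f, 'v) ter \<Rightarrow> real" where
  "ter_dist \<Sigma> = completion_dist (fin_terms \<Sigma>) (fin_dist \<Sigma>)"

definition ter_topology :: "'f msig \<Rightarrow> ('f, 'v) ter topology" where
  "ter_topology \<Sigma> = Metric_space.mtopology (Ter \<Sigma>) (ter_dist \<Sigma>)"

abbreviation ter_rel :: "'f msig \<Rightarrow> (nat \<Rightarrow> ('f, 'v) fterm) rel" where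
  "ter_rel \<Sigma> \<equiv> cauchy_rel (fin_terms \<Sigma>) (fin_dist \<Sigma>)"

definition ter_var :: "'f msig \<Rightarrow> 'v \<Rightarrow> ('f, 'v) ter" where
  "ter_var \<Sigma> x = ter_rel \<Sigma> `` {\<lambda>_. Var x}"

text \<open>Application of a function symbol and renaming of function symbols act pointwise on
  representing sequences; the relational image yields the class of the results.\<close>

definition ter_app :: "'f msig \<Rightarrow> 'f \<Rightarrow> ('f, 'v) ter list \<Rightarrow> ('f, 'v) ter" where
  "ter_app \<Sigma> F cs =
     ter_rel \<Sigma> `` {\<lambda>k. Fun F (map (\<lambda>s. s k) ss) | ss. list_all2 (\<in>) ss cs}"

definition ter_embed :: "'g msig \<Rightarrow> ('f \<Rightarrow> 'g) \<Rightarrow> ('f, 'v) ter \<Rightarrow> ('g, 'v) ter" where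
  "ter_embed \<Sigma> \<phi> c = ter_rel \<Sigma> `` ((\<lambda>s k. map_fterm \<phi> id (s k)) ` c)"

inductive occurs :: "'f msig \<Rightarrow> 'v \<Rightarrow> ('f, 'v) ter \<Rightarrow> bool" for \<Sigma> :: "'f msig" and x :: 'v where
  "occurs \<Sigma> x (ter_var \<Sigma> x)"
| "\<lbrakk>F \<in> symbols \<Sigma>; length cs = arity \<Sigma> F; set cs \<subseteq> Ter \<Sigma>; c \<in> set cs; occurs \<Sigma> x c\<rbrakk>
   \<Longrightarrow> occurs \<Sigma> x (ter_app \<Sigma> F cs)"

primrec fin_subst :: "'f msig \<Rightarrow> ('v \<Rightarrow> ('f, 'v) ter) \<Rightarrow> ('f, 'v) fterm \<Rightarrow> ('f, 'v) ter" where
  "fin_subst \<Sigma> \<sigma> (Var x) = \<sigma> x"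
| "fin_subst \<Sigma> \<sigma> (Fun F ts) = ter_app \<Sigma> F (map (fin_subst \<Sigma> \<sigma>) ts)"

text \<open>Substitution is non-expansive on finite terms; on \<open>Ter\<close> it is the continuous extension.\<close>

definition ter_subst :: "'f msig \<Rightarrow> ('v \<Rightarrow> ('f, 'v) ter) \<Rightarrow> ('f, 'v) ter \<Rightarrow> ('f, 'v) ter" where
  "ter_subst \<Sigma> \<sigma> c =
     (THE u. \<forall>s\<in>c. limitin (ter_topology \<Sigma>) (\<lambda>k. fin_subst \<Sigma> \<sigma> (s k)) u sequentially)"


section \<open>Infinitary term rewriting systems\<close>

record ('f, 'v) itrs =
  sig :: "'f msig"
  rules :: "(('f, 'v) ter \<times> ('f, 'v) ter) set"

definition is_itrs :: "('f, 'v) itrs \<Rightarrow> bool" where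
  "is_itrs R \<longleftrightarrow>
     term_metric (sig R) \<and>
     (\<forall>(l, r)\<in>rules R.
        l \<in> Ter (sig R) \<and> r \<in> Ter (sig R) \<and>
        (\<forall>x. l \<noteq> ter_var (sig R) x) \<and>
        (\<forall>x. occurs (sig R) x r \<longrightarrow> occurs (sig R) x l))"

inductive rstep :: "('f, 'v) itrs \<Rightarrow> ('f, 'v) ter \<Rightarrow> ('f, 'v) ter \<Rightarrow> bool"
    for R :: "('f, 'v) itrs" where
  rule: "(l, r) \<in> rules R \<Longrightarrow> rstep R l r"
| subst: "\<lbrakk>rstep R t u; \<forall>x. \<sigma> x \<in> Ter (sig R)\<rbrakk>
          \<Longrightarrow> rstep R (ter_subst (sig R) \<sigma> t) (ter_subst (sig R) \<sigma> u)"
| ctxt: "\<lbrakk>rstep R t u; F \<in> symbols (sig R); length cs = arity (sig R) F;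
             set cs \<subseteq> Ter (sig R); i < length cs\<rbrakk>
            \<Longrightarrow> rstep R (ter_app (sig R) F (cs[i := t])) (ter_app (sig R) F (cs[i := u]))"


section \<open>Transfinite reduction sequences\<close>

text \<open>An ordinal \<open>\<alpha>\<close> is a well-order relation \<open>r\<close>, its elements being \<open>Field r\<close>.\<close>

definition ord_topology :: "'i rel \<Rightarrow> 'i topology" where
  "ord_topology r =
     topology_generated_by
       ({Field r} \<union> {underS r a | a. a \<in> Field r} \<union> {aboveS r a | a. a \<in> Field r})"

definition ord_succ :: "'i rel \<Rightarrow> 'i option rel" where
  "ord_succ r = map_prod Some Some ` r \<union> (Some ` Field r \<union> {None}) \<times> {None}"

definition limit_ord :: "'i rel \<Rightarrow> bool" where
  "limit_ord r \<longleftrightarrow> Well_order r \<and> Field r \<noteq> {} \<and> (\<forall>a\<in>Field r. aboveS r a \<noteq> {})"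

definition reduction_seq :: "('f, 'v) itrs \<Rightarrow> 'i rel \<Rightarrow> ('i \<Rightarrow> ('f, 'v) ter) \<Rightarrow> bool" where
  "reduction_seq R r f \<longleftrightarrow>
     Well_order r \<and>
     continuous_map (ord_topology r) (ter_topology (sig R)) f \<and>
     (\<forall>\<beta>\<in>Field r. aboveS r \<beta> \<noteq> {} \<longrightarrow> rstep R (f \<beta>) (f (wo_rel.suc r {\<beta>})))"

definition seq_converges :: "('f, 'v) itrs \<Rightarrow> 'i rel \<Rightarrow> ('i \<Rightarrow> ('f, 'v) ter) \<Rightarrow> bool" where
  "seq_converges R r f \<longleftrightarrow>
     (\<exists>g. continuous_map (ord_topology (ord_succ r)) (ter_topology (sig R)) g \<and>
          (\<forall>\<beta>\<in>Field r. g (Some \<beta>) = f \<beta>))"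

text \<open>HOL has no type of all ordinals. The type argument bounds the ordinals considered: they are
  those of well-orders on subsets of \<open>'i\<close>. Results are to be stated for an arbitrary \<open>'i\<close>.\<close>

definition itrs_convergent :: "'i itself \<Rightarrow> ('f, 'v) itrs \<Rightarrow> bool" where
  "itrs_convergent _ R \<longleftrightarrow>
     (\<forall>(r :: 'i rel) f. limit_ord r \<and> reduction_seq R r f \<longrightarrow> seq_converges R r f)"


section \<open>Indirection and strong convergence\<close>

text \<open>The fresh symbol \<open>I\<close> is \<open>None\<close>. The rule \<open>I(x) \<rightarrow> x\<close> is included for every name of the
  variable \<open>x\<close>; by closure under substitutions this does not affect the rewrite relation.\<close>

definition indirect_sig :: "'f msig \<Rightarrow> 'f option msig" where
  "indirect_sig \<Sigma> =
     \<lparr>symbols = insert None (Some ` symbols \<Sigma>),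
      arity = case_option 1 (arity \<Sigma>),
      umap = case_option (\<lambda>x. x 0) (umap \<Sigma>)\<rparr>"

definition indirected :: "('f, 'v) itrs \<Rightarrow> ('f option, 'v) itrs" where
  "indirected R =
     (let \<Sigma> = indirect_sig (sig R) in
      \<lparr>sig = \<Sigma>,
       rules = {(ter_embed \<Sigma> Some l, ter_app \<Sigma> None [ter_embed \<Sigma> Some r]) | l r. (l, r) \<in> rules R}
             \<union> {(ter_app \<Sigma> None [ter_var \<Sigma> x], ter_var \<Sigma> x) | x. True}\<rparr>)"

definition strongly_convergent :: "'i itself \<Rightarrow> ('f, 'v) itrs \<Rightarrow> bool" where
  "strongly_convergent I R \<longleftrightarrow> itrs_convergent I (indirected R)"


section \<open>Disjoint union\<close>

definition disjoint_sigs :: "'f msig \<Rightarrow> 'f msig \<Rightarrow> bool" where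
  "disjoint_sigs \<Sigma> \<Delta> \<longleftrightarrow> symbols \<Sigma> \<inter> symbols \<Delta> = {}"

definition sig_union :: "'f msig \<Rightarrow> 'f msig \<Rightarrow> 'f msig" where
  "sig_union \<Sigma> \<Delta> =
     \<lparr>symbols = symbols \<Sigma> \<union> symbols \<Delta>,
      arity = (\<lambda>F. if F \<in> symbols \<Sigma> then arity \<Sigma> F else arity \<Delta> F),
      umap = (\<lambda>F. if F \<in> symbols \<Sigma> then umap \<Sigma> F else umap \<Delta> F)\<rparr>"

text \<open>Classes of Cauchy sequences over the smaller signatures are not classes over the union,
  so the rules are transported along the canonical embeddings.\<close>

definition itrs_union :: "('f, 'v) itrs \<Rightarrow> ('f, 'v) itrs \<Rightarrow> ('f, 'v) itrs" where
  "itrs_union R S =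
     (let \<Sigma> = sig_union (sig R) (sig S); \<iota> = ter_embed \<Sigma> id in
      \<lparr>sig = \<Sigma>, rules = map_prod \<iota> \<iota> ` rules R \<union> map_prod \<iota> \<iota> ` rules S\<rparr>)"

end

theory Submission
  imports Defs
begin

text \<open>An arity- and metric-preserving injection of signatures is an isometry on finite terms, hence
  extends to an isometric embedding of the completions, which commutes with variables, application
  of symbols and substitution. So it maps rewrite steps to rewrite steps, and reduction sequences to
  reduction sequences. If the image of an open sequence converges, its limit lies in the closure of
  the image of the smaller term space. That space is complete, so its image is closed and the limit
  can be pulled back. Both constituents of a disjoint union embed in this way, and indirection
  preserves embeddings, which settles strong convergence.\<close>

section \<open>Metric completion\<close>

context Metric_space
begin

lemma MCauchy_in_space: "MCauchy \<sigma> \<Longrightarrow> \<sigma> n \<in> M"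
  by (auto simp: MCauchy_def)

lemma MCauchy_iff_tendsto:
  "MCauchy \<sigma> \<longleftrightarrow> range \<sigma> \<subseteq> M \<and> ((\<lambda>(m, n). d (\<sigma> m) (\<sigma> n)) \<longlongrightarrow> 0) (sequentially \<times>\<^sub>F sequentially)"
  unfolding MCauchy_def tendsto_iff eventually_prod_sequentially
  by (simp add: commute)

lemma cauchy_relD:
  assumes "(s, t) \<in> cauchy_rel M d"
  shows "MCauchy s" and "MCauchy t" and "(\<lambda>n. d (s n) (t n)) \<longlonglongrightarrow> 0"
  using assms by (auto simp: cauchy_rel_def)

lemma abs_mdist_diff_le:
  assumes "x \<in> M" "y \<in> M" "x' \<in> M" "y' \<in> M"
  shows "\<bar>d x y - d x' y'\<bar> \<le> d x x' + d y y'"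
  using mdist_reverse_triangle[of x' y' x] mdist_reverse_triangle[of y' x y] assms
  by (simp add: commute)

lemma convergent_mdist:
  assumes s: "MCauchy s" and t: "MCauchy t"
  shows "convergent (\<lambda>n. d (s n) (t n))"
proof -
  have "((\<lambda>(m, n). d (s m) (s n) + d (t m) (t n)) \<longlongrightarrow> 0) (sequentially \<times>\<^sub>F sequentially)"
    using s t tendsto_add[of "\<lambda>(m, n). d (s m) (s n)" 0 _ "\<lambda>(m, n). d (t m) (t n)" 0]
    by (simp add: MCauchy_iff_tendsto split_def)
  moreover have "\<bar>d (s m) (t m) - d (s n) (t n)\<bar> \<le> d (s m) (s n) + d (t m) (t n)" for m n
    using MCauchy_in_space[OF s] MCauchy_in_space[OF t] by (intro abs_mdist_diff_le)
  ultimately have "((\<lambda>(m, n). dist (d (s m) (t m)) (d (s n) (t n))) \<longlongrightarrow> 0)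
      (sequentially \<times>\<^sub>F sequentially)"
    by - (rule Lim_null_comparison[OF always_eventually], auto simp: dist_real_def)
  then show ?thesis
    by (simp add: Met_TC.MCauchy_iff_tendsto flip: Cauchy_convergent_iff MCauchy_iff_Cauchy)
qed

lemma tendsto_mdist_cauchy_rel:
  assumes "(s, s') \<in> cauchy_rel M d" and "(t, t') \<in> cauchy_rel M d"
    and "(\<lambda>n. d (s n) (t n)) \<longlonglongrightarrow> r"
  shows "(\<lambda>n. d (s' n) (t' n)) \<longlonglongrightarrow> r"
proof (rule Lim_transform2[OF assms(3)])
  have "\<bar>d (s n) (t n) - d (s' n) (t' n)\<bar> \<le> d (s n) (s' n) + d (t n) (t' n)" for n
    using assms(1,2)[THEN cauchy_relD(1), THEN MCauchy_in_space]
      assms(1,2)[THEN cauchy_relD(2), THEN MCauchy_in_space] by (intro abs_mdist_diff_le)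
  moreover have "(\<lambda>n. d (s n) (s' n) + d (t n) (t' n)) \<longlonglongrightarrow> 0"
    using assms(1,2)[THEN cauchy_relD(3)] by (rule tendsto_add_zero)
  ultimately show "(\<lambda>n. d (s n) (t n) - d (s' n) (t' n)) \<longlonglongrightarrow> 0"
    by - (rule Lim_null_comparison[OF always_eventually], auto)
qed

lemma cauchy_rel_refl: "MCauchy s \<Longrightarrow> (s, s) \<in> cauchy_rel M d"
  using MCauchy_in_space[of s] by (simp add: cauchy_rel_def)

lemma cauchy_relI:
  assumes s: "MCauchy s" and t: "range t \<subseteq> M" and null: "(\<lambda>n. d (s n) (t n)) \<longlonglongrightarrow> 0"
  shows "(s, t) \<in> cauchy_rel M d"
proof -
  let ?F = "sequentially \<times>\<^sub>F sequentially"
  have "((\<lambda>x. d (s (fst x)) (t (fst x))) \<longlongrightarrow> 0) ?F" "((\<lambda>x. d (s (snd x)) (t (snd x))) \<longlongrightarrow> 0) ?F"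
    using null by (auto intro: filterlim_compose filterlim_fst filterlim_snd)
  moreover have "((\<lambda>x. d (s (fst x)) (s (snd x))) \<longlongrightarrow> 0) ?F"
    using s by (simp add: MCauchy_iff_tendsto split_def)
  ultimately have "((\<lambda>x. d (s (fst x)) (s (snd x)) +
      (d (s (fst x)) (t (fst x)) + d (s (snd x)) (t (snd x)))) \<longlongrightarrow> 0) ?F"
    by (auto intro: tendsto_add_zero)
  moreover have "d (t m) (t n) \<le> d (s m) (s n) + (d (s m) (t m) + d (s n) (t n))" for m n
    using abs_mdist_diff_le[of "s m" "s n" "t m" "t n"] MCauchy_in_space[OF s] range_subsetD[OF t]
    by (simp add: abs_le_iff)
  ultimately have "((\<lambda>x. d (t (fst x)) (t (snd x))) \<longlongrightarrow> 0) ?F"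
    by - (rule Lim_null_comparison[OF always_eventually], auto)
  then show ?thesis
    using s t null by (simp add: cauchy_rel_def MCauchy_iff_tendsto split_def)
qed

lemma limitin_cauchy_rel:
  assumes st: "(s, t) \<in> cauchy_rel M d" and "limitin mtopology s l sequentially"
  shows "limitin mtopology t l sequentially"
proof -
  have l: "l \<in> M" and sl: "(\<lambda>n. d (s n) l) \<longlonglongrightarrow> 0"
    using assms(2) by (simp_all add: limitin_metric_dist_null)
  have "(\<lambda>n. d (t n) l) \<longlonglongrightarrow> 0"
    using tendsto_mdist_cauchy_rel[OF st cauchy_rel_refl sl] l by simp
  moreover have "t n \<in> M" for n
    using cauchy_relD(2)[OF st] by (rule MCauchy_in_space)
  ultimately show ?thesis
    using l by (simp add: limitin_metric_dist_null)
qed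

lemma cauchy_rel_sym: "(s, t) \<in> cauchy_rel M d \<Longrightarrow> (t, s) \<in> cauchy_rel M d"
  by (auto simp: cauchy_rel_def commute)

lemma cauchy_rel_trans:
  assumes st: "(s, t) \<in> cauchy_rel M d" and tu: "(t, u) \<in> cauchy_rel M d"
  shows "(s, u) \<in> cauchy_rel M d"
proof (rule cauchy_relI)
  show s: "MCauchy s"
    by (rule cauchy_relD[OF st])
  show "range u \<subseteq> M"
    using cauchy_relD(2)[OF tu] by (simp add: MCauchy_def)
  show "(\<lambda>n. d (s n) (u n)) \<longlonglongrightarrow> 0"
    by (rule tendsto_mdist_cauchy_rel[OF cauchy_rel_refl[OF s] tu cauchy_relD(3)[OF st]])
qed

lemma equiv_cauchy_rel: "equiv {s. MCauchy s} (cauchy_rel M d)"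
proof (rule equivI)
  show "cauchy_rel M d \<subseteq> {s. MCauchy s} \<times> {s. MCauchy s}"
    using cauchy_relD by auto
  show "refl_on {s. MCauchy s} (cauchy_rel M d)"
    by (simp add: refl_on_def cauchy_rel_refl)
  show "sym (cauchy_rel M d)"
    using cauchy_rel_sym by (rule symI)
  show "trans (cauchy_rel M d)"
    using cauchy_rel_trans by (rule transI)
qed

lemma cauchy_rel_Image_eq_class:
  assumes "s \<in> A" and "\<And>t. t \<in> A \<Longrightarrow> (s, t) \<in> cauchy_rel M d"
  shows "cauchy_rel M d `` A = cauchy_rel M d `` {s}"
  using assms equiv_cauchy_rel unfolding equiv_def by (blast dest: transD)

lemma class_in_completion: "MCauchy s \<Longrightarrow> cauchy_rel M d `` {s} \<in> completion M d"
  by (simp add: completion_def quotientI)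

lemma self_in_class: "MCauchy s \<Longrightarrow> s \<in> cauchy_rel M d `` {s}"
  by (simp add: cauchy_rel_refl)

lemma completion_nonempty:
  assumes "A \<in> completion M d"
  obtains s where "s \<in> A"
  using assms equiv_cauchy_rel in_quotient_imp_non_empty unfolding completion_def by blast

lemma completion_cauchy_rel: "\<lbrakk>A \<in> completion M d; s \<in> A; t \<in> A\<rbrakk> \<Longrightarrow> (s, t) \<in> cauchy_rel M d"
  unfolding completion_def using quotient_eq_iff[OF equiv_cauchy_rel] by blast

lemma completion_MCauchy: "\<lbrakk>A \<in> completion M d; s \<in> A\<rbrakk> \<Longrightarrow> MCauchy s"
  using completion_cauchy_rel cauchy_relD(1) by blast

lemma completion_eqI:
  "\<lbrakk>A \<in> completion M d; B \<in> completion M d; s \<in> A; t \<in> B; (s, t) \<in> cauchy_rel M d\<rbrakk> \<Longrightarrow> A = B"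
  unfolding completion_def using quotient_eq_iff[OF equiv_cauchy_rel] by blast

lemma tendsto_completion_dist:
  assumes A: "A \<in> completion M d" "s \<in> A" and B: "B \<in> completion M d" "t \<in> B"
  shows "(\<lambda>n. d (s n) (t n)) \<longlonglongrightarrow> completion_dist M d A B"
proof -
  obtain r where r: "(\<lambda>n. d (s n) (t n)) \<longlonglongrightarrow> r"
    using convergent_mdist completion_MCauchy A B unfolding convergent_def by blast
  have "(THE r. \<forall>s\<in>A. \<forall>t\<in>B. (\<lambda>n. d (s n) (t n)) \<longlonglongrightarrow> r) = r"
  proof (rule the_equality)
    show "\<forall>s\<in>A. \<forall>t\<in>B. (\<lambda>n. d (s n) (t n)) \<longlonglongrightarrow> r"
      using tendsto_mdist_cauchy_rel[OF completion_cauchy_rel[OF A] completion_cauchy_rel[OF B] r]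
      by blast
    show "r' = r" if "\<forall>s\<in>A. \<forall>t\<in>B. (\<lambda>n. d (s n) (t n)) \<longlonglongrightarrow> r'" for r'
      using that r A B LIMSEQ_unique by blast
  qed
  then show ?thesis
    using r A B by (simp add: completion_dist_def)
qed

lemma completion_dist_eqI:
  assumes "A \<in> completion M d" "s \<in> A" "B \<in> completion M d" "t \<in> B"
    and "(\<lambda>n. d (s n) (t n)) \<longlonglongrightarrow> r"
  shows "completion_dist M d A B = r"
  using tendsto_completion_dist[OF assms(1-4)] assms(5) LIMSEQ_unique by blast

lemma completion_dist_nonneg: "0 \<le> completion_dist M d A B"
proof (cases "A \<in> completion M d \<and> B \<in> completion M d")
  case True
  then obtain s t where "s \<in> A" "t \<in> B"
    by (metis completion_nonempty)
  with True have "(\<lambda>n. d (s n) (t n)) \<longlonglongrightarrow> completion_dist M d A B"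
    by (intro tendsto_completion_dist) auto
  then show ?thesis
    by (rule LIMSEQ_le_const) simp
qed (auto simp: completion_dist_def)

lemma completion_dist_commute: "completion_dist M d A B = completion_dist M d B A"
proof (cases "A \<in> completion M d \<and> B \<in> completion M d")
  case True
  then obtain s t where "s \<in> A" "t \<in> B"
    by (metis completion_nonempty)
  with True show ?thesis
    using tendsto_completion_dist[of B t A s] by (intro completion_dist_eqI) (auto simp: commute)
qed (auto simp: completion_dist_def)

lemma completion_dist_eq_0_iff:
  assumes A: "A \<in> completion M d" and B: "B \<in> completion M d"
  shows "completion_dist M d A B = 0 \<longleftrightarrow> A = B"
proof -
  obtain s t where s: "s \<in> A" and t: "t \<in> B"
    using A B by (metis completion_nonempty)
  have "completion_dist M d A B = 0 \<longleftrightarrow> (\<lambda>n. d (s n) (t n)) \<longlonglongrightarrow> 0"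
    using tendsto_completion_dist[OF A s B t] LIMSEQ_unique by auto
  also have "\<dots> \<longleftrightarrow> (s, t) \<in> cauchy_rel M d"
    using completion_MCauchy A B s t by (auto simp: cauchy_rel_def)
  also have "\<dots> \<longleftrightarrow> A = B"
    using completion_eqI[OF A B s t] completion_cauchy_rel[OF A s] t by blast
  finally show ?thesis .
qed

lemma completion_dist_triangle:
  assumes A: "A \<in> completion M d" and B: "B \<in> completion M d" and C: "C \<in> completion M d"
  shows "completion_dist M d A C \<le> completion_dist M d A B + completion_dist M d B C"
proof -
  obtain s t u where s: "s \<in> A" and t: "t \<in> B" and u: "u \<in> C"
    using A B C by (metis completion_nonempty)
  have "(\<lambda>n. d (s n) (t n) + d (t n) (u n))
      \<longlonglongrightarrow> completion_dist M d A B + completion_dist M d B C"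
    by (intro tendsto_add tendsto_completion_dist A B C s t u)
  moreover have "d (s n) (u n) \<le> d (s n) (t n) + d (t n) (u n)" for n
    using completion_MCauchy A B C s t u by (intro triangle MCauchy_in_space) blast+
  ultimately show ?thesis
    using LIMSEQ_le tendsto_completion_dist[OF A s C u] by blast
qed

lemma Metric_space_completion: "Metric_space (completion M d) (completion_dist M d)"
  by unfold_locales
    (use completion_dist_nonneg completion_dist_commute completion_dist_eq_0_iff
      completion_dist_triangle in auto)

end

section \<open>Isometries and uniformly continuous maps\<close>

locale metric_isometry = Metric_space12 +
  fixes f
  assumes maps_to: "x \<in> M1 \<Longrightarrow> f x \<in> M2"
    and isometry: "\<lbrakk>x \<in> M1; y \<in> M1\<rbrakk> \<Longrightarrow> d2 (f x) (f y) = d1 x y"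
begin

lemma embedding: "embedding_map M1.mtopology M2.mtopology f"
  by (rule isometry_imp_embedding_map) (use maps_to isometry in auto)

lemma inj_on_space: "inj_on f M1"
  using isometry M1.zero by (metis inj_onI)

lemma limitin_image:
  assumes "limitin M1.mtopology \<sigma> l F"
  shows "limitin M2.mtopology (\<lambda>n. f (\<sigma> n)) (f l) F"
proof -
  have "continuous_map M1.mtopology M2.mtopology f"
    using embedding homeomorphic_imp_continuous_map continuous_map_in_subtopology
    unfolding embedding_map_def by blast
  then show ?thesis
    using continuous_map_limit[OF _ assms] by (simp add: o_def)
qed

lemma MCauchy_image_iff:
  assumes "range \<sigma> \<subseteq> M1"
  shows "M2.MCauchy (\<lambda>n. f (\<sigma> n)) \<longleftrightarrow> M1.MCauchy \<sigma>"
  using assms maps_to isometry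
  by (auto simp: M1.MCauchy_def M2.MCauchy_def image_subset_iff)

lemma closedin_image:
  assumes "M1.mcomplete"
  shows "closedin M2.mtopology (f ` M1)"
  unfolding M2.metric_closedin_iff_sequentially_closed
proof (intro conjI strip)
  show "f ` M1 \<subseteq> M2"
    using maps_to by auto
  fix \<tau> :: "nat \<Rightarrow> _" and l
  assume "range \<tau> \<subseteq> f ` M1 \<and> limitin M2.mtopology \<tau> l sequentially"
  then have "\<forall>n. \<exists>x\<in>M1. \<tau> n = f x" and lim: "limitin M2.mtopology \<tau> l sequentially"
    by auto
  then obtain \<sigma> where "\<forall>n. \<sigma> n \<in> M1 \<and> \<tau> n = f (\<sigma> n)"
    by metis
  then have \<sigma>: "range \<sigma> \<subseteq> M1" and \<tau>: "\<tau> = (\<lambda>n. f (\<sigma> n))"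
    by auto
  have "M2.MCauchy \<tau>"
    using M2.convergent_imp_MCauchy[OF _ lim] \<sigma> \<tau> maps_to by auto
  then obtain l' where l': "limitin M1.mtopology \<sigma> l' sequentially"
    using assms MCauchy_image_iff[OF \<sigma>] \<tau> unfolding M1.mcomplete_def by blast
  then have "f l' = l"
    using M2.limitin_metric_unique[OF limitin_image[OF l']] lim \<tau> by simp
  then show "l \<in> f ` M1"
    using l' M1.limitin_mspace by blast
qed

lemma uniformly_continuous: "uniformly_continuous_map (metric (M1, d1)) (metric (M2, d2)) f"
  by (auto simp: uniformly_continuous_map_def maps_to isometry)

end

definition completion_map ::
    "'b set \<Rightarrow> ('b \<Rightarrow> 'b \<Rightarrow> real) \<Rightarrow> ('a \<Rightarrow> 'b) \<Rightarrow> (nat \<Rightarrow> 'a) set \<Rightarrow> (nat \<Rightarrow> 'b) set" where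
  "completion_map M d f A = cauchy_rel M d `` ((\<lambda>s n. f (s n)) ` A)"

context Metric_space12
begin

context
  fixes f
  assumes f: "uniformly_continuous_map (metric (M1, d1)) (metric (M2, d2)) f"
begin

lemma cauchy_rel_image:
  assumes st: "(s, t) \<in> cauchy_rel M1 d1"
  shows "((\<lambda>n. f (s n)), (\<lambda>n. f (t n))) \<in> cauchy_rel M2 d2"
proof -
  have "M2.MCauchy (\<lambda>n. f (\<sigma> n))" if "M1.MCauchy \<sigma>" for \<sigma>
    using uniformly_imp_Cauchy_continuous_map[OF f] that
    by (simp add: Cauchy_continuous_map_def o_def)
  moreover have "(\<lambda>n. d2 (f (s n)) (f (t n))) \<longlonglongrightarrow> 0"
    using f M1.cauchy_relD[OF st]
    by (simp add: uniformly_continuous_map_sequentially M1.MCauchy_def)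
  ultimately show ?thesis
    using M1.cauchy_relD[OF st] by (simp add: cauchy_rel_def)
qed

lemma completion_map_eq_class:
  assumes "A \<in> completion M1 d1" "s \<in> A"
  shows "completion_map M2 d2 f A = cauchy_rel M2 d2 `` {\<lambda>n. f (s n)}"
  unfolding completion_map_def
  using assms cauchy_rel_image M1.completion_cauchy_rel
  by (intro M2.cauchy_rel_Image_eq_class) blast+

lemma MCauchy_image:
  assumes "M1.MCauchy s"
  shows "M2.MCauchy (\<lambda>n. f (s n))"
  using M1.cauchy_rel_refl[OF assms] cauchy_rel_image M2.cauchy_relD by blast

lemma completion_map_in_completion:
  assumes A: "A \<in> completion M1 d1"
  shows "completion_map M2 d2 f A \<in> completion M2 d2"
proof -
  obtain s where s: "s \<in> A"
    using A by (rule M1.completion_nonempty)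
  then show ?thesis
    using A M1.completion_MCauchy[OF A]
    by (simp add: completion_map_eq_class M2.class_in_completion MCauchy_image)
qed

lemma image_in_completion_map:
  assumes "A \<in> completion M1 d1" "s \<in> A"
  shows "(\<lambda>n. f (s n)) \<in> completion_map M2 d2 f A"
  unfolding completion_map_eq_class[OF assms]
  using assms M1.completion_MCauchy by (intro M2.self_in_class MCauchy_image)

lemma ex1_limitin_completion:
  assumes "M2.mcomplete" and A: "A \<in> completion M1 d1"
  shows "\<exists>!l. \<forall>s\<in>A. limitin M2.mtopology (\<lambda>n. f (s n)) l sequentially"
proof -
  obtain s where s: "s \<in> A"
    using A by (rule M1.completion_nonempty)
  then obtain l where l: "limitin M2.mtopology (\<lambda>n. f (s n)) l sequentially"
    using MCauchy_image M1.completion_MCauchy A assms(1) unfolding M2.mcomplete_def by blast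
  show ?thesis
  proof (rule ex1I)
    show "\<forall>t\<in>A. limitin M2.mtopology (\<lambda>n. f (t n)) l sequentially"
      using M2.limitin_cauchy_rel[OF cauchy_rel_image l] M1.completion_cauchy_rel[OF A s] by blast
    show "l' = l" if "\<forall>t\<in>A. limitin M2.mtopology (\<lambda>n. f (t n)) l' sequentially" for l'
      using that s l M2.limitin_metric_unique trivial_limit_sequentially by blast
  qed
qed

end

end

lemma completion_map_comp:
  assumes "Metric_space12 M1 d1 M2 d2" "Metric_space12 M2 d2 M3 d3"
    and f: "uniformly_continuous_map (metric (M1, d1)) (metric (M2, d2)) f"
    and g: "uniformly_continuous_map (metric (M2, d2)) (metric (M3, d3)) g"
    and A: "A \<in> completion M1 d1"
  shows "completion_map M3 d3 g (completion_map M2 d2 f A) = completion_map M3 d3 (g \<circ> f) A"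
proof -
  interpret F: Metric_space12 M1 d1 M2 d2 by fact
  interpret G: Metric_space12 M2 d2 M3 d3 by fact
  interpret GF: Metric_space12 M1 d1 M3 d3 ..
  obtain s where s: "s \<in> A"
    using A by (rule F.M1.completion_nonempty)
  have gf: "uniformly_continuous_map (metric (M1, d1)) (metric (M3, d3)) (g \<circ> f)"
    using f g by (rule uniformly_continuous_map_compose)
  show ?thesis
    unfolding GF.completion_map_eq_class[OF gf A s]
      G.completion_map_eq_class[OF g F.completion_map_in_completion[OF f A]
        F.image_in_completion_map[OF f A s]]
    by simp
qed

lemma (in metric_isometry) metric_isometry_completion_map:
  "metric_isometry (completion M1 d1) (completion_dist M1 d1)
     (completion M2 d2) (completion_dist M2 d2) (completion_map M2 d2 f)"
proof (intro metric_isometry.intro Metric_space12.intro metric_isometry_axioms.intro)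
  show "Metric_space (completion M1 d1) (completion_dist M1 d1)"
    by (rule M1.Metric_space_completion)
  show "Metric_space (completion M2 d2) (completion_dist M2 d2)"
    by (rule M2.Metric_space_completion)
  show "completion_map M2 d2 f A \<in> completion M2 d2" if "A \<in> completion M1 d1" for A
    using uniformly_continuous that by (rule completion_map_in_completion)
next
  fix A B assume A: "A \<in> completion M1 d1" and B: "B \<in> completion M1 d1"
  obtain s t where s: "s \<in> A" and t: "t \<in> B"
    using A B by (metis M1.completion_nonempty)
  have "(\<lambda>n. d2 (f (s n)) (f (t n))) = (\<lambda>n. d1 (s n) (t n))"
    using isometry M1.MCauchy_in_space M1.completion_MCauchy A B s t by blast
  then show "completion_dist M2 d2 (completion_map M2 d2 f A) (completion_map M2 d2 f B)
      = completion_dist M1 d1 A B"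
    using M1.tendsto_completion_dist[OF A s B t]
    by (intro M2.completion_dist_eqI[OF
          completion_map_in_completion[OF uniformly_continuous A]
          image_in_completion_map[OF uniformly_continuous A s]
          completion_map_in_completion[OF uniformly_continuous B]
          image_in_completion_map[OF uniformly_continuous B t]]) simp
qed

section \<open>Completeness of the completion\<close>

context Metric_space
begin

definition point_class :: "'a \<Rightarrow> (nat \<Rightarrow> 'a) set" where
  "point_class x = cauchy_rel M d `` {\<lambda>_. x}"

lemma metric_isometry_point_class:
  "metric_isometry M d (completion M d) (completion_dist M d) point_class"
proof (intro metric_isometry.intro Metric_space12.intro metric_isometry_axioms.intro)
  show "Metric_space M d" ..
  show "Metric_space (completion M d) (completion_dist M d)"
    by (rule Metric_space_completion)
  show "point_class x \<in> completion M d" if "x \<in> M" for x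
    using that by (simp add: point_class_def class_in_completion)
  show "completion_dist M d (point_class x) (point_class y) = d x y" if "x \<in> M" "y \<in> M" for x y
    unfolding point_class_def
    using that
    by (intro completion_dist_eqI[OF class_in_completion self_in_class
          class_in_completion self_in_class]) auto
qed

lemma tendsto_completion_dist_point_class:
  assumes A: "A \<in> completion M d" and s: "s \<in> A"
  shows "(\<lambda>n. completion_dist M d (point_class (s n)) A) \<longlonglongrightarrow> 0"
proof (rule LIMSEQ_I)
  have cauchy: "MCauchy s"
    using A s by (rule completion_MCauchy)
  fix e :: real assume "0 < e"
  then obtain N where N: "\<forall>n n'. N \<le> n \<longrightarrow> N \<le> n' \<longrightarrow> d (s n) (s n') < e/2"
    using cauchy unfolding MCauchy_def by (meson half_gt_zero)
  have "completion_dist M d (point_class (s n)) A \<le> e/2" if "n \<ge> N" for n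
  proof (rule LIMSEQ_le_const2)
    show "(\<lambda>k. d (s n) (s k)) \<longlonglongrightarrow> completion_dist M d (point_class (s n)) A"
      unfolding point_class_def using A s MCauchy_in_space[OF cauchy]
      by (intro tendsto_completion_dist class_in_completion self_in_class) auto
    show "\<exists>N. \<forall>k\<ge>N. d (s n) (s k) \<le> e/2"
      using N that by (meson less_imp_le)
  qed
  then show "\<exists>N. \<forall>n\<ge>N. norm (completion_dist M d (point_class (s n)) A - 0) < e"
    using \<open>0 < e\<close> completion_dist_nonneg by (intro exI[of _ N]) fastforce
qed

lemma point_class_dense:
  assumes A: "A \<in> completion M d" and "0 < e"
  obtains x where "x \<in> M" "completion_dist M d (point_class x) A < e"
proof -
  obtain s where s: "s \<in> A"
    using A by (rule completion_nonempty)
  have "eventually (\<lambda>n. completion_dist M d (point_class (s n)) A < e) sequentially"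
    using tendsto_completion_dist_point_class[OF A s] \<open>0 < e\<close> by (rule order_tendstoD(2))
  then show thesis
    using that MCauchy_in_space[OF completion_MCauchy[OF A s]]
    by (auto simp: eventually_sequentially)
qed

lemma mcomplete_completion: "Metric_space.mcomplete (completion M d) (completion_dist M d)"
proof -
  interpret metric_isometry M d "completion M d" "completion_dist M d" point_class
    by (rule metric_isometry_point_class)
  have "\<exists>L. limitin M2.mtopology A L sequentially" if A: "M2.MCauchy A" for A
  proof -
    have "\<exists>x. x \<in> M \<and> completion_dist M d (point_class x) (A n) < inverse (real (Suc n))" for n
      using point_class_dense[OF M2.MCauchy_in_space[OF A]]
      by (metis inverse_positive_iff_positive of_nat_0_less_iff zero_less_Suc)
    then obtain x where x: "\<And>n. x n \<in> M"
      and close: "\<And>n. completion_dist M d (point_class (x n)) (A n) < inverse (real (Suc n))"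
      by metis
    have "(\<lambda>n. completion_dist M d (A n) (point_class (x n))) \<longlonglongrightarrow> 0"
      by (rule tendsto_sandwich[OF _ _ tendsto_const LIMSEQ_inverse_real_of_nat])
         (use close in \<open>auto simp: less_imp_le M2.commute\<close>)
    then have Ax: "(A, \<lambda>n. point_class (x n)) \<in> cauchy_rel (completion M d) (completion_dist M d)"
      using A x maps_to by (intro M2.cauchy_relI) auto
    then have "MCauchy x"
      using MCauchy_image_iff x M2.cauchy_relD(2) by blast
    then have X: "cauchy_rel M d `` {x} \<in> completion M d" "x \<in> cauchy_rel M d `` {x}"
      by (rule class_in_completion, rule self_in_class)
    then have "limitin M2.mtopology (\<lambda>n. point_class (x n)) (cauchy_rel M d `` {x}) sequentially"
      using x maps_to tendsto_completion_dist_point_class[OF X]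
      by (simp add: M2.limitin_metric_dist_null)
    moreover have "((\<lambda>n. point_class (x n)), A) \<in> cauchy_rel (completion M d) (completion_dist M d)"
      using Ax by (rule M2.cauchy_rel_sym)
    ultimately show ?thesis
      using M2.limitin_cauchy_rel by blast
  qed
  then show ?thesis
    by (simp add: M2.mcomplete_def)
qed

end

section \<open>Closed embeddings\<close>

lemma embedding_map_continuous_map_iff:
  assumes e: "embedding_map X Y e"
  shows "continuous_map Z X f \<longleftrightarrow>
    f ` topspace Z \<subseteq> topspace X \<and> continuous_map Z Y (\<lambda>z. e (f z))"
    (is "_ \<longleftrightarrow> ?rhs")
proof
  obtain e' where "homeomorphic_maps X (subtopology Y (e ` topspace X)) e e'"
    using e by (auto simp: embedding_map_def homeomorphic_map_maps)
  then have e: "continuous_map X Y e" and e': "continuous_map (subtopology Y (e ` topspace X)) X e'"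
    and inverse: "\<And>x. x \<in> topspace X \<Longrightarrow> e' (e x) = x"
    by (auto simp: homeomorphic_maps_def continuous_map_in_subtopology)
  show ?rhs if f: "continuous_map Z X f"
    using continuous_map_compose[OF f e] continuous_map_image_subset_topspace[OF f]
    by (simp add: o_def)
  show "continuous_map Z X f" if f: ?rhs
  proof (rule continuous_map_eq)
    have "continuous_map Z (subtopology Y (e ` topspace X)) (\<lambda>z. e (f z))"
      using f by (auto simp: continuous_map_in_subtopology)
    then show "continuous_map Z X (e' \<circ> (\<lambda>z. e (f z)))"
      using e' by (rule continuous_map_compose)
  qed (use f inverse in auto)
qed

lemma closed_embedding_lift:
  assumes e: "embedding_map X Y e" and closed: "closedin Y (e ` topspace X)"
    and g: "continuous_map Z Y g"
    and dense: "Z closure_of D = topspace Z" and D: "g ` D \<subseteq> e ` topspace X"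
  obtains h where "continuous_map Z X h" "\<And>z. z \<in> topspace Z \<Longrightarrow> e (h z) = g z"
proof -
  have "g ` topspace Z \<subseteq> Y closure_of (g ` D)"
    using continuous_map_image_closure_subset[OF g, of D] dense by simp
  also have "\<dots> \<subseteq> e ` topspace X"
    using D closed by (rule closure_of_minimal)
  finally have image: "g z \<in> e ` topspace X" if "z \<in> topspace Z" for z
    using that by blast
  define h where "h z = inv_into (topspace X) e (g z)" for z
  have eh: "e (h z) = g z" if "z \<in> topspace Z" for z
    using image[OF that] by (simp add: h_def f_inv_into_f)
  have "h ` topspace Z \<subseteq> topspace X"
    using image by (auto simp: h_def intro: inv_into_into)
  moreover have "continuous_map Z Y (\<lambda>z. e (h z))"
    by (rule continuous_map_eq[OF g]) (simp add: eh)
  ultimately have "continuous_map Z X h"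
    by (simp add: embedding_map_continuous_map_iff[OF e])
  then show thesis
    using eh by (rule that)
qed

section \<open>The order topology of ordinals\<close>

lemma topspace_ord_topology: "topspace (ord_topology r) = Field r"
  by (auto simp: ord_topology_def underS_def aboveS_def intro: FieldI1 FieldI2)

lemma aboveS_decr:
  assumes "trans r" "antisym r" "(a, b) \<in> r"
  shows "aboveS r b \<subseteq> aboveS r a"
  using assms unfolding aboveS_def by (auto dest: transD antisymD)

lemma aboveS_directed:
  assumes r: "Linear_order r" and a: "a \<in> Field r" and b: "b \<in> Field r"
  obtains c where "c \<in> {a, b}" "aboveS r c \<subseteq> aboveS r a \<inter> aboveS r b"
proof -
  have "(a, b) \<in> r \<or> (b, a) \<in> r"
    using Linear_order_in_diff_Id[OF r a b] by auto
  moreover have "aboveS r y \<subseteq> aboveS r x" if "(x, y) \<in> r" for x y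
    using r that by (intro aboveS_decr) (auto simp: order_on_defs)
  ultimately show thesis
    using that[of a] that[of b] by blast
qed

lemma openin_ord_topology_maximum:
  assumes r: "Linear_order r" and max: "aboveS r m = {}" and nonempty: "underS r m \<noteq> {}"
    and U: "openin (ord_topology r) U" "m \<in> U"
  shows "\<exists>a\<in>underS r m. aboveS r a \<subseteq> U"
proof -
  have "generate_topology_on
      ({Field r} \<union> {underS r a | a. a \<in> Field r} \<union> {aboveS r a | a. a \<in> Field r}) U"
    using U(1) by (simp add: ord_topology_def openin_topology_generated_by_iff)
  then show ?thesis
    using U(2)
  proof (induction rule: generate_topology_on.induct)
    case Empty
    then show ?case by simp
  next
    case (Int V W)
    then obtain a b where a: "a \<in> underS r m" "aboveS r a \<subseteq> V"
      and b: "b \<in> underS r m" "aboveS r b \<subseteq> W"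
      by blast
    obtain c where "c \<in> {a, b}" "aboveS r c \<subseteq> aboveS r a \<inter> aboveS r b"
      by (rule aboveS_directed[OF r a(1)[THEN underS_Field] b(1)[THEN underS_Field]])
    then show ?case
      using a b by blast
  next
    case (UN K)
    then show ?case by blast
  next
    case (Basis V)
    then consider (whole) "V = Field r" | (below) a where "V = underS r a"
      | (above) a where "V = aboveS r a"
      by blast
    then show ?case
    proof cases
      case whole
      then show ?thesis
        using nonempty by (auto simp: aboveS_def intro: FieldI2)
    qed (use Basis.prems max in \<open>auto simp: underS_def aboveS_def\<close>)
  qed
qed

lemma Field_ord_succ: "Field (ord_succ r) = insert None (Some ` Field r)"
  unfolding ord_succ_def Field_def by force

lemma Some_in_ord_succ_iff: "(Some a, Some b) \<in> ord_succ r \<longleftrightarrow> (a, b) \<in> r"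
  by (auto simp: ord_succ_def)

lemma None_in_ord_succ_iff:
  "(x, None) \<in> ord_succ r \<longleftrightarrow> x \<in> insert None (Some ` Field r)"
  "(None, x) \<in> ord_succ r \<longleftrightarrow> x = None"
  by (auto simp: ord_succ_def)

lemma Linear_order_ord_succ:
  assumes "Linear_order r"
  shows "Linear_order (ord_succ r)"
proof -
  have "Refl (ord_succ r)"
    using assms
    by (auto simp: order_on_defs refl_on_def Field_ord_succ Some_in_ord_succ_iff
        None_in_ord_succ_iff)
  moreover have "trans (ord_succ r)"
  proof (rule transI)
    fix x y z assume "(x, y) \<in> ord_succ r" "(y, z) \<in> ord_succ r"
    then show "(x, z) \<in> ord_succ r"
      using assms unfolding order_on_defs
      by (cases x; cases y; cases z)
         (auto simp: Some_in_ord_succ_iff None_in_ord_succ_iff intro: FieldI1 dest: transD)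
  qed
  moreover have "antisym (ord_succ r)"
  proof (rule antisymI)
    fix x y assume "(x, y) \<in> ord_succ r" "(y, x) \<in> ord_succ r"
    then show "x = y"
      using assms unfolding order_on_defs
      by (cases x; cases y) (auto simp: Some_in_ord_succ_iff None_in_ord_succ_iff dest: antisymD)
  qed
  moreover have "Total (ord_succ r)"
    using assms
    by (auto simp: order_on_defs total_on_def Field_ord_succ Some_in_ord_succ_iff
        None_in_ord_succ_iff)
  ultimately show ?thesis
    by (auto simp: order_on_defs intro: FieldI1 FieldI2)
qed

lemma dense_in_ord_succ:
  assumes "limit_ord r"
  shows "ord_topology (ord_succ r) closure_of (Some ` Field r)
      = topspace (ord_topology (ord_succ r))"
proof -
  have r: "Linear_order r" and "Field r \<noteq> {}" and no_max: "\<And>a. a \<in> Field r \<Longrightarrow> aboveS r a \<noteq> {}"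
    using assms by (auto simp: limit_ord_def well_order_on_def)
  have under: "underS (ord_succ r) None = Some ` Field r" and above: "aboveS (ord_succ r) None = {}"
    by (auto simp: underS_def aboveS_def None_in_ord_succ_iff)
  have "\<exists>y\<in>Some ` Field r. y \<in> U" if U: "openin (ord_topology (ord_succ r)) U" "None \<in> U" for U
  proof -
    obtain a where "a \<in> Field r" and a: "aboveS (ord_succ r) (Some a) \<subseteq> U"
      using openin_ord_topology_maximum[OF Linear_order_ord_succ[OF r] above _ U] under
        \<open>Field r \<noteq> {}\<close> by auto
    then obtain b where "b \<in> aboveS r a"
      using no_max by blast
    then have "b \<in> Field r" and "Some b \<in> aboveS (ord_succ r) (Some a)"
      by (auto simp: aboveS_def Some_in_ord_succ_iff intro: FieldI2)
    then show ?thesis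
      using a by blast
  qed
  then show ?thesis
    by (auto simp: in_closure_of topspace_ord_topology Field_ord_succ)
qed

section \<open>Ultra-metric maps\<close>

lemma umm_range: "umm n f \<Longrightarrow> x \<in> cube n \<Longrightarrow> f x \<in> {0..1}"
  by (auto simp: umm_def)

lemma umm_eq_0_iff: "umm n f \<Longrightarrow> x \<in> cube n \<Longrightarrow> f x = 0 \<longleftrightarrow> (\<forall>i<n. x i = 0)"
  by (simp add: umm_def)

lemma umm_max:
  "umm n f \<Longrightarrow> x \<in> cube n \<Longrightarrow> y \<in> cube n \<Longrightarrow> f (\<lambda>i\<in>{..<n}. max (x i) (y i)) = max (f x) (f y)"
  by (simp add: umm_def)

lemma umm_mono:
  assumes f: "umm n f" and x: "x \<in> cube n" and y: "y \<in> cube n"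
    and le: "\<And>i. i < n \<Longrightarrow> x i \<le> y i"
  shows "f x \<le> f y"
proof -
  have "(\<lambda>i\<in>{..<n}. max (x i) (y i)) = y"
    using y le by (auto simp: fun_eq_iff PiE_iff extensional_def)
  then show ?thesis
    using umm_max[OF f x y] by simp
qed

lemma umm_le_max:
  assumes f: "umm n f" and x: "x \<in> cube n" and y: "y \<in> cube n" and z: "z \<in> cube n"
    and le: "\<And>i. i < n \<Longrightarrow> x i \<le> max (y i) (z i)"
  shows "f x \<le> max (f y) (f z)"
proof -
  have "(\<lambda>i\<in>{..<n}. max (y i) (z i)) \<in> cube n"
    using y z by (auto simp: PiE_iff le_max_iff_disj)
  then have "f x \<le> f (\<lambda>i\<in>{..<n}. max (y i) (z i))"
    using le by (intro umm_mono[OF f x]) auto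
  then show ?thesis
    by (simp add: umm_max[OF f y z])
qed

lemma continuous_umm_tendsto:
  assumes f: "continuous_umm n f" and X: "\<And>k. X k \<in> cube n" and x: "x \<in> cube n"
    and lim: "\<And>i. i < n \<Longrightarrow> ((\<lambda>k. X k i) \<longlongrightarrow> x i) F"
  shows "((\<lambda>k. f (X k)) \<longlongrightarrow> f x) F"
proof -
  have "limitin (top_of_set {0..1}) (\<lambda>k. X k i) (x i) F" if "i < n" for i
    using that lim X x by (auto simp: limitin_subtopology PiE_iff)
  then have "limitin (product_topology (\<lambda>_. top_of_set {0..1}) {..<n}) X x F"
    unfolding limitin_componentwise using X x by (auto simp: PiE_iff)
  with f have "limitin (top_of_set {0..1}) (f \<circ> X) (f x) F"
    unfolding continuous_umm_def by (intro continuous_map_limit) auto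
  then show ?thesis
    by (simp add: limitin_subtopology o_def)
qed

definition dist_vec :: "('a \<Rightarrow> 'a \<Rightarrow> real) \<Rightarrow> 'a list \<Rightarrow> 'a list \<Rightarrow> nat \<Rightarrow> real" where
  "dist_vec d xs ys = (\<lambda>i\<in>{..<length xs}. d (xs ! i) (ys ! i))"

lemma dist_vec_nth: "i < length xs \<Longrightarrow> dist_vec d xs ys i = d (xs ! i) (ys ! i)"
  by (simp add: dist_vec_def)

lemma dist_vec_in_cube:
  assumes "length xs = n" and "\<And>i. i < n \<Longrightarrow> d (xs ! i) (ys ! i) \<in> {0..1}"
  shows "dist_vec d xs ys \<in> cube n"
  unfolding dist_vec_def assms(1) by (rule restrict_PiE_iff[THEN iffD2]) (use assms(2) in auto)

lemma dist_vec_eqI: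
  assumes "length xs' = length xs"
    and "\<And>i. i < length xs \<Longrightarrow> d (xs ! i) (ys ! i) = d' (xs' ! i) (ys' ! i)"
  shows "dist_vec d xs ys = dist_vec d' xs' ys'"
  using assms by (simp add: dist_vec_def restrict_def fun_eq_iff)

section \<open>Finite terms\<close>

primrec root_symbol :: "('f, 'v) fterm \<Rightarrow> 'v + 'f" where
  "root_symbol (Var x) = Inl x"
| "root_symbol (Fun F ts) = Inr F"

lemma fin_terms_Fun_iff:
  "Fun F ts \<in> fin_terms \<Sigma> \<longleftrightarrow>
     F \<in> symbols \<Sigma> \<and> length ts = arity \<Sigma> F \<and> (\<forall>t\<in>set ts. t \<in> fin_terms \<Sigma>)"
  by (auto intro: fin_terms.Fun elim: fin_terms.cases)

lemma fin_terms_pair_induct [consumes 2, case_names Var Fun root_neq]: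
  assumes "t \<in> fin_terms \<Sigma>" "u \<in> fin_terms \<Sigma>"
    and "\<And>x. P (Var x) (Var x)"
    and "\<And>F ts us. \<lbrakk>Fun F ts \<in> fin_terms \<Sigma>; Fun F us \<in> fin_terms \<Sigma>;
      \<And>i. i < arity \<Sigma> F \<Longrightarrow> P (ts ! i) (us ! i)\<rbrakk> \<Longrightarrow> P (Fun F ts) (Fun F us)"
    and "\<And>t u. \<lbrakk>t \<in> fin_terms \<Sigma>; u \<in> fin_terms \<Sigma>; root_symbol t \<noteq> root_symbol u\<rbrakk> \<Longrightarrow> P t u"
  shows "P t u"
  using assms(1,2)
proof (induction t arbitrary: u rule: fterm.induct)
  case (Var x)
  then show ?case
    using assms(3,5) by (cases "u = Var x"; cases u) auto
next
  case (Fun F ts)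
  show ?case
  proof (cases "root_symbol u = Inr F")
    case True
    then obtain us where u: "u = Fun F us"
      by (cases u) auto
    have "P (ts ! i) (us ! i)" if "i < arity \<Sigma> F" for i
      using Fun.IH[of "ts ! i" "us ! i"] Fun.prems that by (simp add: u fin_terms_Fun_iff)
    then show ?thesis
      using assms(4) Fun.prems by (simp add: u)
  qed (use assms(5) Fun.prems in auto)
qed

lemma fin_dist_Var: "fin_dist \<Sigma> (Var x) (Var x) = 0"
  by (simp add: fin_dist_def)

lemma fin_dist_Fun:
  assumes "Fun F ts \<in> fin_terms \<Sigma>" "Fun F us \<in> fin_terms \<Sigma>"
  shows "fin_dist \<Sigma> (Fun F ts) (Fun F us) = umap \<Sigma> F (dist_vec (fin_dist \<Sigma>) ts us)"
proof -
  have "dist_vec (pre_dist (umap \<Sigma>)) ts us = dist_vec (fin_dist \<Sigma>) ts us"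
    using assms by (intro dist_vec_eqI) (auto simp: fin_dist_def fin_terms_Fun_iff)
  then show ?thesis
    using assms by (simp add: fin_dist_def dist_vec_def restrict_def)
qed

lemma fin_dist_root_neq:
  "\<lbrakk>t \<in> fin_terms \<Sigma>; u \<in> fin_terms \<Sigma>; root_symbol t \<noteq> root_symbol u\<rbrakk> \<Longrightarrow> fin_dist \<Sigma> t u = 1"
  by (cases t; cases u) (auto simp: fin_dist_def)

section \<open>The space of terms\<close>

text \<open>The parameter \<open>V\<close> only fixes the type of variables, which a metric space of terms depends on
  although the signature does not.\<close>

locale term_space =
  fixes \<Sigma> :: "'f msig" and V :: "'v itself"
  assumes term_metric: "term_metric \<Sigma>"
begin

lemma umap_continuous: "F \<in> symbols \<Sigma> \<Longrightarrow> continuous_umm (arity \<Sigma> F) (umap \<Sigma> F)"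
  using term_metric by (simp add: term_metric_def)

lemma umap_umm: "F \<in> symbols \<Sigma> \<Longrightarrow> umm (arity \<Sigma> F) (umap \<Sigma> F)"
  using umap_continuous by (simp add: continuous_umm_def)

lemma fin_dist_range: "fin_dist \<Sigma> t u \<in> {0..1}"
proof (cases "t \<in> fin_terms \<Sigma> \<and> u \<in> fin_terms \<Sigma>")
  case True
  then have "t \<in> fin_terms \<Sigma>" "u \<in> fin_terms \<Sigma>"
    by auto
  then show ?thesis
  proof (induction rule: fin_terms_pair_induct)
    case (Fun F ts us)
    then have "dist_vec (fin_dist \<Sigma>) ts us \<in> cube (arity \<Sigma> F)"
      by (intro dist_vec_in_cube) (auto simp: fin_terms_Fun_iff)
    then show ?case
      using Fun umm_range[OF umap_umm] by (simp add: fin_dist_Fun fin_terms_Fun_iff)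
  qed (auto simp: fin_dist_Var fin_dist_root_neq)
qed (auto simp: fin_dist_def)

lemma fin_dist_vec_in_cube: "length ts = n \<Longrightarrow> dist_vec (fin_dist \<Sigma>) ts us \<in> cube n"
  using fin_dist_range by (intro dist_vec_in_cube)

lemma fin_dist_commute: "fin_dist \<Sigma> t u = fin_dist \<Sigma> u t"
proof (cases "t \<in> fin_terms \<Sigma> \<and> u \<in> fin_terms \<Sigma>")
  case True
  then have "t \<in> fin_terms \<Sigma>" "u \<in> fin_terms \<Sigma>"
    by auto
  then show ?thesis
  proof (induction rule: fin_terms_pair_induct)
    case (Fun F ts us)
    then have "dist_vec (fin_dist \<Sigma>) ts us = dist_vec (fin_dist \<Sigma>) us ts"
      by (intro dist_vec_eqI) (auto simp: fin_terms_Fun_iff)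
    then show ?case
      using Fun by (simp add: fin_dist_Fun)
  qed (auto simp: fin_dist_root_neq)
qed (auto simp: fin_dist_def)

lemma fin_dist_eq_0_iff:
  assumes "t \<in> fin_terms \<Sigma>" "u \<in> fin_terms \<Sigma>"
  shows "fin_dist \<Sigma> t u = 0 \<longleftrightarrow> t = u"
  using assms
proof (induction rule: fin_terms_pair_induct)
  case (Fun F ts us)
  then have F: "F \<in> symbols \<Sigma>" and len: "length ts = arity \<Sigma> F" "length us = arity \<Sigma> F"
    by (auto simp: fin_terms_Fun_iff)
  have "fin_dist \<Sigma> (Fun F ts) (Fun F us) = 0 \<longleftrightarrow> (\<forall>i<arity \<Sigma> F. dist_vec (fin_dist \<Sigma>) ts us i = 0)"
    using Fun umm_eq_0_iff[OF umap_umm[OF F] fin_dist_vec_in_cube[OF len(1)]]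
    by (simp add: fin_dist_Fun)
  also have "\<dots> \<longleftrightarrow> (\<forall>i<arity \<Sigma> F. ts ! i = us ! i)"
    using Fun.IH len by (simp add: dist_vec_nth)
  also have "\<dots> \<longleftrightarrow> Fun F ts = Fun F us"
    using len by (simp add: list_eq_iff_nth_eq)
  finally show ?case .
qed (auto simp: fin_dist_Var fin_dist_root_neq)

lemma fin_dist_ultrametric:
  assumes "t \<in> fin_terms \<Sigma>" "v \<in> fin_terms \<Sigma>" "u \<in> fin_terms \<Sigma>"
  shows "fin_dist \<Sigma> t v \<le> max (fin_dist \<Sigma> t u) (fin_dist \<Sigma> u v)"
  using assms
proof (induction arbitrary: u rule: fin_terms_pair_induct)
  case (Var x)
  then show ?case
    using fin_dist_range[of "Var x" u] by (simp add: fin_dist_Var le_max_iff_disj)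
next
  case (Fun F ts vs)
  show ?case
  proof (cases "root_symbol u = Inr F")
    case True
    then obtain us where u: "u = Fun F us"
      by (cases u) auto
    have F: "F \<in> symbols \<Sigma>" "length ts = arity \<Sigma> F" "length us = arity \<Sigma> F"
      using Fun.hyps Fun.prems u by (auto simp: fin_terms_Fun_iff)
    have "umap \<Sigma> F (dist_vec (fin_dist \<Sigma>) ts vs)
        \<le> max (umap \<Sigma> F (dist_vec (fin_dist \<Sigma>) ts us)) (umap \<Sigma> F (dist_vec (fin_dist \<Sigma>) us vs))"
      using F Fun.IH Fun.prems u
      by (intro umm_le_max[OF umap_umm] fin_dist_vec_in_cube)
         (auto simp: dist_vec_nth fin_terms_Fun_iff)
    then show ?thesis
      using Fun.hyps Fun.prems by (simp add: u fin_dist_Fun)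
  next
    case False
    then have "fin_dist \<Sigma> (Fun F ts) u = 1"
      using Fun.hyps Fun.prems by (intro fin_dist_root_neq) auto
    then show ?thesis
      using fin_dist_range[of "Fun F ts" "Fun F vs"] by (simp add: le_max_iff_disj)
  qed
next
  case (root_neq t v)
  then have "fin_dist \<Sigma> t u = 1 \<or> fin_dist \<Sigma> u v = 1"
    using fin_dist_root_neq by metis
  then show ?case
    using fin_dist_range[of t v] by (auto simp: le_max_iff_disj)
qed

lemma Metric_space_fin_terms: "Metric_space (fin_terms \<Sigma> :: ('f, 'v) fterm set) (fin_dist \<Sigma>)"
proof
  fix t u v :: "('f, 'v) fterm"
  assume "t \<in> fin_terms \<Sigma>" "u \<in> fin_terms \<Sigma>" "v \<in> fin_terms \<Sigma>"
  then have "fin_dist \<Sigma> t v \<le> max (fin_dist \<Sigma> t u) (fin_dist \<Sigma> u v)"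
    by (intro fin_dist_ultrametric)
  then show "fin_dist \<Sigma> t v \<le> fin_dist \<Sigma> t u + fin_dist \<Sigma> u v"
    using fin_dist_range[of t u] fin_dist_range[of u v] by auto
qed (auto simp: fin_dist_eq_0_iff fin_dist_range[simplified] intro: fin_dist_commute)

sublocale fin: Metric_space "fin_terms \<Sigma> :: ('f, 'v) fterm set" "fin_dist \<Sigma>"
  rewrites "completion (fin_terms \<Sigma>) (fin_dist \<Sigma>) = Ter \<Sigma>"
    and "completion_dist (fin_terms \<Sigma>) (fin_dist \<Sigma>) = ter_dist \<Sigma>"
  by (rule Metric_space_fin_terms) (simp_all add: Ter_def ter_dist_def)

sublocale ter: Metric_space "Ter \<Sigma> :: ('f, 'v) ter set" "ter_dist \<Sigma>"
  rewrites "Metric_space.mtopology (Ter \<Sigma>) (ter_dist \<Sigma>) = ter_topology \<Sigma>"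
  by (rule fin.Metric_space_completion) (simp add: ter_topology_def)

lemma ter_dist_range:
  fixes c c' :: "('f, 'v) ter"
  assumes c: "c \<in> Ter \<Sigma>" and c': "c' \<in> Ter \<Sigma>"
  shows "ter_dist \<Sigma> c c' \<in> {0..1}"
proof -
  obtain s t where s: "s \<in> c" and t: "t \<in> c'"
    using c c' by (metis fin.completion_nonempty)
  show ?thesis
    using closed_atLeastAtMost fin_dist_range fin.tendsto_completion_dist[OF c s c' t]
    by (rule closed_sequentially)
qed

end

section \<open>Application of function symbols\<close>

definition app_seq :: "'f \<Rightarrow> (nat \<Rightarrow> ('f, 'v) fterm) list \<Rightarrow> nat \<Rightarrow> ('f, 'v) fterm" where
  "app_seq F ss = (\<lambda>k. Fun F (map (\<lambda>s. s k) ss))"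

context term_space
begin

lemma tendsto_fin_dist_Fun:
  assumes ts: "\<And>k. Fun F (ts k) \<in> fin_terms \<Sigma>" and us: "\<And>k. Fun F (us k) \<in> fin_terms \<Sigma>"
    and x: "x \<in> cube (arity \<Sigma> F)"
    and lim: "\<And>i. i < arity \<Sigma> F \<Longrightarrow> ((\<lambda>k. fin_dist \<Sigma> (ts k ! i) (us k ! i)) \<longlongrightarrow> x i) G"
  shows "((\<lambda>k. fin_dist \<Sigma> (Fun F (ts k)) (Fun F (us k))) \<longlongrightarrow> umap \<Sigma> F x) G"
proof -
  have F: "F \<in> symbols \<Sigma>" and len: "\<And>k. length (ts k) = arity \<Sigma> F"
    using ts by (auto simp: fin_terms_Fun_iff)
  have "((\<lambda>k. umap \<Sigma> F (dist_vec (fin_dist \<Sigma>) (ts k) (us k))) \<longlongrightarrow> umap \<Sigma> F x) G"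
    using umap_continuous[OF F] fin_dist_vec_in_cube[OF len] x
    by (rule continuous_umm_tendsto) (simp add: dist_vec_nth len lim)
  then show ?thesis
    by (simp add: fin_dist_Fun ts us)
qed

lemma tendsto_fin_dist_Fun_0:
  assumes "\<And>k. Fun F (ts k) \<in> fin_terms \<Sigma>" and "\<And>k. Fun F (us k) \<in> fin_terms \<Sigma>"
    and "\<And>i. i < arity \<Sigma> F \<Longrightarrow> ((\<lambda>k. fin_dist \<Sigma> (ts k ! i) (us k ! i)) \<longlongrightarrow> 0) G"
  shows "((\<lambda>k. fin_dist \<Sigma> (Fun F (ts k)) (Fun F (us k))) \<longlongrightarrow> 0) G"
proof -
  let ?zero = "\<lambda>i\<in>{..<arity \<Sigma> F}. 0 :: real"
  have F: "F \<in> symbols \<Sigma>"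
    using assms(1) by (simp add: fin_terms_Fun_iff)
  have zero: "?zero \<in> cube (arity \<Sigma> F)"
    by auto
  have "((\<lambda>k. fin_dist \<Sigma> (Fun F (ts k)) (Fun F (us k))) \<longlongrightarrow> umap \<Sigma> F ?zero) G"
    using assms by (intro tendsto_fin_dist_Fun zero) auto
  moreover have "umap \<Sigma> F ?zero = 0"
    by (simp add: umm_eq_0_iff[OF umap_umm[OF F] zero])
  ultimately show ?thesis
    by simp
qed

lemma app_seq_in_fin_terms:
  assumes "F \<in> symbols \<Sigma>" "length ss = arity \<Sigma> F" "\<And>s. s \<in> set ss \<Longrightarrow> fin.MCauchy s"
  shows "app_seq F ss k \<in> fin_terms \<Sigma>"
  using assms fin.MCauchy_in_space by (auto simp: app_seq_def fin_terms_Fun_iff)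

lemma MCauchy_app_seq:
  assumes F: "F \<in> symbols \<Sigma>" and len: "length ss = arity \<Sigma> F"
    and cauchy: "\<And>s. s \<in> set ss \<Longrightarrow> fin.MCauchy s"
  shows "fin.MCauchy (app_seq F ss)"
proof -
  have "((\<lambda>x. fin_dist \<Sigma> (Fun F (map (\<lambda>s. s (fst x)) ss)) (Fun F (map (\<lambda>s. s (snd x)) ss)))
      \<longlongrightarrow> 0) (sequentially \<times>\<^sub>F sequentially)"
  proof (rule tendsto_fin_dist_Fun_0)
    show "((\<lambda>x. fin_dist \<Sigma> (map (\<lambda>s. s (fst x)) ss ! i) (map (\<lambda>s. s (snd x)) ss ! i)) \<longlongrightarrow> 0)
        (sequentially \<times>\<^sub>F sequentially)" if "i < arity \<Sigma> F" for i
      using cauchy[of "ss ! i"] that by (simp add: fin.MCauchy_iff_tendsto len split_def)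
  qed (use app_seq_in_fin_terms[OF assms] in \<open>simp_all add: app_seq_def\<close>)
  then show ?thesis
    using app_seq_in_fin_terms[OF assms]
    by (auto simp: fin.MCauchy_iff_tendsto app_seq_def split_def)
qed

lemma cauchy_rel_app_seq:
  fixes ss ts :: "(nat \<Rightarrow> ('f, 'v) fterm) list"
  assumes F: "F \<in> symbols \<Sigma>" and len: "length ss = arity \<Sigma> F"
    and rel: "list_all2 (\<lambda>s t. (s, t) \<in> ter_rel \<Sigma>) ss ts"
  shows "(app_seq F ss, app_seq F ts) \<in> ter_rel \<Sigma>"
proof (rule fin.cauchy_relI)
  have ss: "fin.MCauchy s" if "s \<in> set ss" for s
    using that rel fin.cauchy_relD(1) by (fastforce simp: list_all2_conv_all_nth in_set_conv_nth)
  have ts: "fin.MCauchy t" if "t \<in> set ts" for t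
    using that rel fin.cauchy_relD(2) by (fastforce simp: list_all2_conv_all_nth in_set_conv_nth)
  have len_ts: "length ts = arity \<Sigma> F"
    using rel len by (simp add: list_all2_lengthD)
  show "fin.MCauchy (app_seq F ss)"
    using F len ss by (rule MCauchy_app_seq)
  show "range (app_seq F ts) \<subseteq> fin_terms \<Sigma>"
    using app_seq_in_fin_terms[OF F len_ts ts] by auto
  show "(\<lambda>n. fin_dist \<Sigma> (app_seq F ss n) (app_seq F ts n)) \<longlonglongrightarrow> 0"
    unfolding app_seq_def
  proof (rule tendsto_fin_dist_Fun_0)
    show "(\<lambda>k. fin_dist \<Sigma> (map (\<lambda>s. s k) ss ! i) (map (\<lambda>s. s k) ts ! i)) \<longlonglongrightarrow> 0"
      if "i < arity \<Sigma> F" for i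
      using that fin.cauchy_relD(3)[of "ss ! i" "ts ! i"] rel len len_ts
      by (simp add: list_all2_conv_all_nth)
  qed (use app_seq_in_fin_terms[OF F len ss] app_seq_in_fin_terms[OF F len_ts ts]
      in \<open>simp_all add: app_seq_def\<close>)
qed

lemma args_representatives:
  fixes cs :: "('f, 'v) ter list"
  assumes "set cs \<subseteq> Ter \<Sigma>"
  obtains ss where "list_all2 (\<in>) ss cs"
proof
  have "c \<noteq> {}" if "c \<in> set cs" for c
    using that assms fin.completion_nonempty[of c] by auto
  then show "list_all2 (\<in>) (map (\<lambda>c. SOME s. s \<in> c) cs) cs"
    by (auto simp: list_all2_conv_all_nth some_in_eq)
qed

lemma args_MCauchy:
  fixes cs :: "('f, 'v) ter list"
  assumes "set cs \<subseteq> Ter \<Sigma>" "list_all2 (\<in>) ss cs" "s \<in> set ss"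
  shows "fin.MCauchy s"
  using assms fin.completion_MCauchy
  by (fastforce simp: list_all2_conv_all_nth in_set_conv_nth subset_iff)

context
  fixes F :: 'f and cs :: "('f, 'v) ter list"
  assumes F: "F \<in> symbols \<Sigma>" and cs: "length cs = arity \<Sigma> F" "set cs \<subseteq> Ter \<Sigma>"
begin

lemma MCauchy_app_seq_representatives:
  assumes "list_all2 (\<in>) ss cs"
  shows "fin.MCauchy (app_seq F ss)"
  using assms F cs args_MCauchy by (intro MCauchy_app_seq) (auto dest: list_all2_lengthD)

lemma ter_app_eq_class:
  assumes ss: "list_all2 (\<in>) ss cs"
  shows "ter_app \<Sigma> F cs = ter_rel \<Sigma> `` {app_seq F ss}"
proof -
  have "ter_app \<Sigma> F cs = ter_rel \<Sigma> `` {app_seq F ts | ts. list_all2 (\<in>) ts cs}"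
    by (simp add: ter_app_def app_seq_def)
  also have "\<dots> = ter_rel \<Sigma> `` {app_seq F ss}"
  proof (rule fin.cauchy_rel_Image_eq_class)
    fix s assume "s \<in> {app_seq F ts | ts. list_all2 (\<in>) ts cs}"
    then obtain ts where s: "s = app_seq F ts" and ts: "list_all2 (\<in>) ts cs"
      by blast
    have "(ss ! i, ts ! i) \<in> ter_rel \<Sigma>" if "i < length cs" for i
      using that ss ts cs(2) fin.completion_cauchy_rel[of "cs ! i"]
      by (simp add: list_all2_conv_all_nth subset_iff)
    then have "list_all2 (\<lambda>s t. (s, t) \<in> ter_rel \<Sigma>) ss ts"
      using ss ts by (simp add: list_all2_conv_all_nth)
    moreover have "length ss = arity \<Sigma> F"
      using list_all2_lengthD[OF ss] cs(1) by simp
    ultimately show "(app_seq F ss, s) \<in> ter_rel \<Sigma>"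
      unfolding s by (intro cauchy_rel_app_seq F)
  qed (use ss in blast)
  finally show ?thesis .
qed

lemma app_seq_in_ter_app: "list_all2 (\<in>) ss cs \<Longrightarrow> app_seq F ss \<in> ter_app \<Sigma> F cs"
  using fin.self_in_class[OF MCauchy_app_seq_representatives] ter_app_eq_class by blast

lemma ter_app_in_Ter: "ter_app \<Sigma> F cs \<in> Ter \<Sigma>"
proof -
  obtain ss where ss: "list_all2 (\<in>) ss cs"
    using cs(2) by (rule args_representatives)
  show ?thesis
    unfolding ter_app_eq_class[OF ss]
    using ss by (intro fin.class_in_completion MCauchy_app_seq_representatives)
qed

end

lemma ter_dist_app:
  fixes cs ds :: "('f, 'v) ter list"
  assumes F: "F \<in> symbols \<Sigma>"
    and cs: "length cs = arity \<Sigma> F" "set cs \<subseteq> Ter \<Sigma>"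
    and ds: "length ds = arity \<Sigma> F" "set ds \<subseteq> Ter \<Sigma>"
  shows "ter_dist \<Sigma> (ter_app \<Sigma> F cs) (ter_app \<Sigma> F ds) = umap \<Sigma> F (dist_vec (ter_dist \<Sigma>) cs ds)"
proof -
  obtain ss ts where ss: "list_all2 (\<in>) ss cs" and ts: "list_all2 (\<in>) ts ds"
    using cs(2) ds(2) by (metis args_representatives)
  have len: "length ss = arity \<Sigma> F" "length ts = arity \<Sigma> F"
    using ss ts cs ds by (auto dest: list_all2_lengthD)
  have Ter: "cs ! i \<in> Ter \<Sigma>" "ds ! i \<in> Ter \<Sigma>" if "i < arity \<Sigma> F" for i
    using that cs ds by auto
  have "(\<lambda>k. fin_dist \<Sigma> (app_seq F ss k) (app_seq F ts k))
      \<longlonglongrightarrow> umap \<Sigma> F (dist_vec (ter_dist \<Sigma>) cs ds)"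
    unfolding app_seq_def
  proof (rule tendsto_fin_dist_Fun)
    show "Fun F (map (\<lambda>s. s k) ss) \<in> fin_terms \<Sigma>" "Fun F (map (\<lambda>s. s k) ts) \<in> fin_terms \<Sigma>" for k
      using app_seq_in_fin_terms[OF F len(1) args_MCauchy[OF cs(2) ss]]
        app_seq_in_fin_terms[OF F len(2) args_MCauchy[OF ds(2) ts]] by (simp_all add: app_seq_def)
    show "dist_vec (ter_dist \<Sigma>) cs ds \<in> cube (arity \<Sigma> F)"
      using cs(1) Ter by (intro dist_vec_in_cube ter_dist_range)
    show "(\<lambda>k. fin_dist \<Sigma> (map (\<lambda>s. s k) ss ! i) (map (\<lambda>s. s k) ts ! i))
        \<longlonglongrightarrow> dist_vec (ter_dist \<Sigma>) cs ds i" if "i < arity \<Sigma> F" for i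
      using that fin.tendsto_completion_dist[of "cs ! i" "ss ! i" "ds ! i" "ts ! i"]
        ss ts cs(1) ds(1) len Ter
      by (simp add: dist_vec_nth list_all2_conv_all_nth)
  qed
  then show ?thesis
    using F cs ds ss ts
    by (intro fin.completion_dist_eqI[OF _ app_seq_in_ter_app _ app_seq_in_ter_app] ter_app_in_Ter)
qed

lemma Var_in_ter_var: "(\<lambda>_. Var x) \<in> (ter_var \<Sigma> x :: ('f, 'v) ter)"
  unfolding ter_var_def by (rule fin.self_in_class) (simp add: fin_terms.Var)

lemma ter_var_in_Ter: "ter_var \<Sigma> x \<in> (Ter \<Sigma> :: ('f, 'v) ter set)"
  unfolding ter_var_def by (rule fin.class_in_completion) (simp add: fin_terms.Var)

end

section \<open>Substitution\<close>

context term_space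
begin

context
  fixes \<sigma> :: "'v \<Rightarrow> ('f, 'v) ter"
  assumes \<sigma>: "\<forall>x. \<sigma> x \<in> Ter \<Sigma>"
begin

lemma fin_subst_in_Ter: "t \<in> fin_terms \<Sigma> \<Longrightarrow> fin_subst \<Sigma> \<sigma> t \<in> Ter \<Sigma>"
  by (induction t rule: fin_terms.induct) (auto simp: \<sigma> intro!: ter_app_in_Ter)

lemma fin_subst_nonexpansive:
  assumes "t \<in> fin_terms \<Sigma>" "u \<in> fin_terms \<Sigma>"
  shows "ter_dist \<Sigma> (fin_subst \<Sigma> \<sigma> t) (fin_subst \<Sigma> \<sigma> u) \<le> fin_dist \<Sigma> t u"
  using assms
proof (induction rule: fin_terms_pair_induct)
  case (Var x)
  then show ?case
    by (simp add: \<sigma> fin_dist_Var)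
next
  case (Fun F ts us)
  let ?cs = "map (fin_subst \<Sigma> \<sigma>) ts" and ?ds = "map (fin_subst \<Sigma> \<sigma>) us"
  have F: "F \<in> symbols \<Sigma>" and len: "length ts = arity \<Sigma> F" "length us = arity \<Sigma> F"
    and Ter: "set ?cs \<subseteq> Ter \<Sigma>" "set ?ds \<subseteq> Ter \<Sigma>"
    using Fun.hyps fin_subst_in_Ter by (auto simp: fin_terms_Fun_iff)
  have "ter_dist \<Sigma> (fin_subst \<Sigma> \<sigma> (Fun F ts)) (fin_subst \<Sigma> \<sigma> (Fun F us))
      = umap \<Sigma> F (dist_vec (ter_dist \<Sigma>) ?cs ?ds)"
    using ter_dist_app[OF F _ Ter(1) _ Ter(2)] len by simp
  also have "\<dots> \<le> umap \<Sigma> F (dist_vec (fin_dist \<Sigma>) ts us)"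
  proof (rule umm_mono[OF umap_umm[OF F]])
    have "?cs ! i \<in> Ter \<Sigma>" "?ds ! i \<in> Ter \<Sigma>" if "i < arity \<Sigma> F" for i
      using that Ter len by (metis length_map nth_mem subsetD)+
    then show "dist_vec (ter_dist \<Sigma>) ?cs ?ds \<in> cube (arity \<Sigma> F)"
      using len by (intro dist_vec_in_cube ter_dist_range) auto
    show "dist_vec (ter_dist \<Sigma>) ?cs ?ds i \<le> dist_vec (fin_dist \<Sigma>) ts us i"
      if "i < arity \<Sigma> F" for i
      using that Fun.IH len by (simp add: dist_vec_nth)
  qed (rule fin_dist_vec_in_cube[OF len(1)])
  also have "\<dots> = fin_dist \<Sigma> (Fun F ts) (Fun F us)"
    using Fun.hyps by (simp add: fin_dist_Fun)
  finally show ?case .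
next
  case (root_neq t u)
  then show ?case
    using ter_dist_range[OF fin_subst_in_Ter fin_subst_in_Ter, of t u]
    by (simp add: fin_dist_root_neq)
qed

lemma ter_subst_limitin:
  assumes c: "c \<in> Ter \<Sigma>" and s: "s \<in> c"
  shows "limitin (ter_topology \<Sigma>) (\<lambda>k. fin_subst \<Sigma> \<sigma> (s k)) (ter_subst \<Sigma> \<sigma> c) sequentially"
proof -
  interpret subst: Metric_space12
    "fin_terms \<Sigma> :: ('f, 'v) fterm set" "fin_dist \<Sigma>" "Ter \<Sigma> :: ('f, 'v) ter set" "ter_dist \<Sigma>" ..
  have "Lipschitz_continuous_map (metric (fin_terms \<Sigma>, fin_dist \<Sigma>)) (metric (Ter \<Sigma>, ter_dist \<Sigma>))
      (fin_subst \<Sigma> \<sigma>)"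
    using fin_subst_in_Ter fin_subst_nonexpansive
    by (auto simp: Lipschitz_continuous_map_def intro!: exI[of _ 1])
  then have "\<exists>!l. \<forall>s\<in>c. limitin (ter_topology \<Sigma>) (\<lambda>k. fin_subst \<Sigma> \<sigma> (s k)) l sequentially"
    using c
      subst.ex1_limitin_completion[OF _ fin.mcomplete_completion, folded Ter_def ter_topology_def]
    by (simp add: Lipschitz_imp_uniformly_continuous_map)
  then show ?thesis
    using s unfolding ter_subst_def by (rule theI'[THEN bspec])
qed

lemma ter_subst_eqI:
  assumes "c \<in> Ter \<Sigma>" "s \<in> c"
    and "limitin (ter_topology \<Sigma>) (\<lambda>k. fin_subst \<Sigma> \<sigma> (s k)) l sequentially"
  shows "ter_subst \<Sigma> \<sigma> c = l"
  using ter.limitin_metric_unique[OF ter_subst_limitin[OF assms(1,2)] assms(3)] by simp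

lemma ter_subst_in_Ter:
  assumes "c \<in> Ter \<Sigma>"
  shows "ter_subst \<Sigma> \<sigma> c \<in> Ter \<Sigma>"
  using assms ter_subst_limitin ter.limitin_mspace by (meson fin.completion_nonempty)

end

end

section \<open>Embeddings of signatures\<close>

locale sig_embedding = src: term_space \<Sigma> V + tgt: term_space \<Delta> V
  for \<Sigma> :: "'f msig" and \<Delta> :: "'g msig" and \<phi> :: "'f \<Rightarrow> 'g" and V :: "'v itself" +
  assumes inj: "inj_on \<phi> (symbols \<Sigma>)"
    and symbol: "F \<in> symbols \<Sigma> \<Longrightarrow> \<phi> F \<in> symbols \<Delta>"
    and arity_eq: "F \<in> symbols \<Sigma> \<Longrightarrow> arity \<Delta> (\<phi> F) = arity \<Sigma> F"
    and umap_eq: "F \<in> symbols \<Sigma> \<Longrightarrow> umap \<Delta> (\<phi> F) = umap \<Sigma> F"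
begin

abbreviation map_symbols :: "('f, 'v) fterm \<Rightarrow> ('g, 'v) fterm" where
  "map_symbols \<equiv> map_fterm \<phi> id"

abbreviation \<iota> :: "('f, 'v) ter \<Rightarrow> ('g, 'v) ter" where
  "\<iota> \<equiv> ter_embed \<Delta> \<phi>"

lemma map_symbols_in_fin_terms: "t \<in> fin_terms \<Sigma> \<Longrightarrow> map_symbols t \<in> fin_terms \<Delta>"
  by (induction t rule: fin_terms.induct)
     (auto simp: fin_terms_Fun_iff symbol arity_eq intro: fin_terms.Var)

lemma root_symbol_map_symbols_eq_iff:
  assumes "t \<in> fin_terms \<Sigma>" "u \<in> fin_terms \<Sigma>"
  shows "root_symbol (map_symbols t) = root_symbol (map_symbols u) \<longleftrightarrow> root_symbol t = root_symbol u"
  using assms inj by (cases t; cases u) (auto simp: fin_terms_Fun_iff dest: inj_onD)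

lemma fin_dist_map_symbols:
  assumes "t \<in> fin_terms \<Sigma>" "u \<in> fin_terms \<Sigma>"
  shows "fin_dist \<Delta> (map_symbols t) (map_symbols u) = fin_dist \<Sigma> t u"
  using assms
proof (induction rule: fin_terms_pair_induct)
  case (Var x)
  then show ?case by (simp add: fin_dist_Var)
next
  case (Fun F ts us)
  have F: "F \<in> symbols \<Sigma>" and len: "length ts = arity \<Sigma> F" "length us = arity \<Sigma> F"
    using Fun.hyps by (auto simp: fin_terms_Fun_iff)
  then have "dist_vec (fin_dist \<Delta>) (map map_symbols ts) (map map_symbols us)
      = dist_vec (fin_dist \<Sigma>) ts us"
    using Fun.IH by (intro dist_vec_eqI) (auto simp: id_def)
  then show ?case
    using Fun.hyps[THEN map_symbols_in_fin_terms] Fun.hyps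
    by (simp add: fin_dist_Fun umap_eq F id_def)
next
  case (root_neq t u)
  then have "root_symbol (map_symbols t) \<noteq> root_symbol (map_symbols u)"
    by (simp only: root_symbol_map_symbols_eq_iff not_False_eq_True)
  then show ?case
    using root_neq map_symbols_in_fin_terms by (simp add: fin_dist_root_neq id_def)
qed

lemma completion_map_eq_ter_embed:
  "completion_map (fin_terms \<Delta>) (fin_dist \<Delta>) map_symbols = \<iota>"
  by (simp add: fun_eq_iff completion_map_def ter_embed_def)

sublocale fin: metric_isometry
  "fin_terms \<Sigma> :: ('f, 'v) fterm set" "fin_dist \<Sigma>"
  "fin_terms \<Delta> :: ('g, 'v) fterm set" "fin_dist \<Delta>" map_symbols
  rewrites "completion (fin_terms \<Sigma>) (fin_dist \<Sigma>) = Ter \<Sigma>"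
    and "completion_dist (fin_terms \<Sigma>) (fin_dist \<Sigma>) = ter_dist \<Sigma>"
    and "completion (fin_terms \<Delta>) (fin_dist \<Delta>) = Ter \<Delta>"
    and "completion_dist (fin_terms \<Delta>) (fin_dist \<Delta>) = ter_dist \<Delta>"
    and "completion_map (fin_terms \<Delta>) (fin_dist \<Delta>) map_symbols = \<iota>"
  by unfold_locales
    (simp_all add: map_symbols_in_fin_terms fin_dist_map_symbols Ter_def ter_dist_def
      completion_map_eq_ter_embed)

sublocale ter: metric_isometry
  "Ter \<Sigma> :: ('f, 'v) ter set" "ter_dist \<Sigma>" "Ter \<Delta> :: ('g, 'v) ter set" "ter_dist \<Delta>" \<iota>
  rewrites "Metric_space.mtopology (Ter \<Sigma>) (ter_dist \<Sigma>) = ter_topology \<Sigma>"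
    and "Metric_space.mtopology (Ter \<Delta>) (ter_dist \<Delta>) = ter_topology \<Delta>"
  by (rule fin.metric_isometry_completion_map) (simp_all add: ter_topology_def)

lemmas ter_embed_eq_class =
  fin.completion_map_eq_class[OF fin.uniformly_continuous, unfolded completion_map_eq_ter_embed]
lemmas ter_embed_representative =
  fin.image_in_completion_map[OF fin.uniformly_continuous, unfolded completion_map_eq_ter_embed]

lemma ter_embed_var: "\<iota> (ter_var \<Sigma> x) = ter_var \<Delta> x"
  using ter_embed_eq_class[OF src.ter_var_in_Ter src.Var_in_ter_var] by (simp add: ter_var_def)

lemma map_symbols_app_seq:
  "map_symbols (app_seq F ss k) = app_seq (\<phi> F) (map (\<lambda>s k. map_symbols (s k)) ss) k"
  by (simp add: app_seq_def)

lemma ter_embed_app: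
  assumes F: "F \<in> symbols \<Sigma>" and cs: "length cs = arity \<Sigma> F" "set cs \<subseteq> Ter \<Sigma>"
  shows "\<iota> (ter_app \<Sigma> F cs) = ter_app \<Delta> (\<phi> F) (map \<iota> cs)"
proof -
  obtain ss where ss: "list_all2 (\<in>) ss cs"
    using cs(2) by (rule src.args_representatives)
  have "list_all2 (\<in>) (map (\<lambda>s k. map_symbols (s k)) ss) (map \<iota> cs)"
    using ss cs by (auto simp: list_all2_conv_all_nth intro!: ter_embed_representative)
  then have "ter_app \<Delta> (\<phi> F) (map \<iota> cs)
      = ter_rel \<Delta> `` {app_seq (\<phi> F) (map (\<lambda>s k. map_symbols (s k)) ss)}"
    using F cs by (intro tgt.ter_app_eq_class) (auto simp: symbol arity_eq intro: ter.maps_to)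
  also have "\<dots> = \<iota> (ter_app \<Sigma> F cs)"
    unfolding ter_embed_eq_class[OF src.ter_app_in_Ter[OF F cs] src.app_seq_in_ter_app[OF F cs ss]]
    by (simp add: map_symbols_app_seq)
  finally show ?thesis ..
qed

lemma ter_embed_fin_subst:
  assumes \<sigma>: "\<forall>x. \<sigma> x \<in> Ter \<Sigma>" and "t \<in> fin_terms \<Sigma>"
  shows "\<iota> (fin_subst \<Sigma> \<sigma> t) = fin_subst \<Delta> (\<lambda>x. \<iota> (\<sigma> x)) (map_symbols t)"
  using assms(2)
proof (induction t rule: fin_terms.induct)
  case (Fun F ts)
  then have "set (map (fin_subst \<Sigma> \<sigma>) ts) \<subseteq> Ter \<Sigma>"
    using src.fin_subst_in_Ter[OF \<sigma>] by auto
  then show ?case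
    using Fun by (simp add: ter_embed_app cong: map_cong)
qed simp

lemma ter_embed_subst:
  assumes \<sigma>: "\<forall>x. \<sigma> x \<in> Ter \<Sigma>" and c: "c \<in> Ter \<Sigma>"
  shows "\<iota> (ter_subst \<Sigma> \<sigma> c) = ter_subst \<Delta> (\<lambda>x. \<iota> (\<sigma> x)) (\<iota> c)"
proof -
  obtain s where s: "s \<in> c"
    using c by (rule src.fin.completion_nonempty)
  have "s k \<in> fin_terms \<Sigma>" for k
    using src.fin.MCauchy_in_space[OF src.fin.completion_MCauchy[OF c s]] .
  then have "limitin (ter_topology \<Delta>)
      (\<lambda>k. fin_subst \<Delta> (\<lambda>x. \<iota> (\<sigma> x)) (map_symbols (s k))) (\<iota> (ter_subst \<Sigma> \<sigma> c)) sequentially"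
    using ter.limitin_image[OF src.ter_subst_limitin[OF \<sigma> c s]] by (simp add: ter_embed_fin_subst \<sigma>)
  then show ?thesis
    using \<sigma> ter.maps_to
    by (intro tgt.ter_subst_eqI[OF _ ter.maps_to[OF c] ter_embed_representative[OF c s], symmetric])
       auto
qed

end

lemma ter_embed_comp:
  fixes c :: "('f, 'v) ter"
  assumes "sig_embedding \<Sigma> \<Delta> \<phi>" and "sig_embedding \<Delta> \<Theta> \<psi>" and c: "c \<in> Ter \<Sigma>"
  shows "ter_embed \<Theta> \<psi> (ter_embed \<Delta> \<phi> c) = ter_embed \<Theta> (\<psi> \<circ> \<phi>) c"
proof -
  interpret \<phi>: sig_embedding \<Sigma> \<Delta> \<phi> "TYPE('v)" by fact
  interpret \<psi>: sig_embedding \<Delta> \<Theta> \<psi> "TYPE('v)" by fact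
  show ?thesis
    using completion_map_comp[OF \<phi>.fin.Metric_space12_axioms \<psi>.fin.Metric_space12_axioms
        \<phi>.fin.uniformly_continuous \<psi>.fin.uniformly_continuous c[unfolded Ter_def]]
    by (simp add: completion_map_def ter_embed_def fterm.map_comp o_def id_def)
qed

section \<open>Transfer of convergence along embeddings\<close>

locale itrs_embedding = sig_embedding "sig R" "sig S" \<phi> "TYPE('v)"
  for R :: "('f, 'v) itrs" and S :: "('g, 'v) itrs" and \<phi> :: "'f \<Rightarrow> 'g" +
  assumes rules_in_Ter: "(l, r) \<in> rules R \<Longrightarrow> l \<in> Ter (sig R) \<and> r \<in> Ter (sig R)"
    and rules_embed: "(l, r) \<in> rules R \<Longrightarrow> (\<iota> l, \<iota> r) \<in> rules S"
begin

lemma rstep_embed: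
  assumes "rstep R t u"
  shows "t \<in> Ter (sig R) \<and> u \<in> Ter (sig R) \<and> rstep S (\<iota> t) (\<iota> u)"
  using assms
proof (induction rule: rstep.induct)
  case (rule l r)
  then show ?case
    using rules_in_Ter rules_embed rstep.rule by blast
next
  case (subst t u \<sigma>)
  then have "rstep S (ter_subst (sig S) (\<lambda>x. \<iota> (\<sigma> x)) (\<iota> t))
      (ter_subst (sig S) (\<lambda>x. \<iota> (\<sigma> x)) (\<iota> u))"
    by (intro rstep.subst) (auto intro: ter.maps_to)
  then show ?case
    using subst by (simp add: ter_embed_subst src.ter_subst_in_Ter)
next
  case (ctxt t u F cs i)
  have args: "set (cs[i := t]) \<subseteq> Ter (sig R)" "set (cs[i := u]) \<subseteq> Ter (sig R)"
    using ctxt set_update_subset_insert[of cs i] by blast+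
  have "rstep S (ter_app (sig S) (\<phi> F) ((map \<iota> cs)[i := \<iota> t]))
                (ter_app (sig S) (\<phi> F) ((map \<iota> cs)[i := \<iota> u]))"
    using ctxt by (intro rstep.ctxt) (auto simp: symbol arity_eq intro: ter.maps_to)
  then show ?case
    using ctxt args by (simp add: ter_embed_app src.ter_app_in_Ter map_update)
qed

lemma reduction_seq_embed:
  assumes "reduction_seq R r f"
  shows "reduction_seq S r (\<lambda>\<beta>. \<iota> (f \<beta>))"
  using assms rstep_embed
  by (simp add: reduction_seq_def embedding_map_continuous_map_iff[OF ter.embedding])

lemma seq_converges_reflect:
  assumes r: "limit_ord r" and f: "reduction_seq R r f"
    and conv: "seq_converges S r (\<lambda>\<beta>. \<iota> (f \<beta>))"
  shows "seq_converges R r f"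
proof -
  obtain g where g: "continuous_map (ord_topology (ord_succ r)) (ter_topology (sig S)) g"
    and gf: "\<And>\<beta>. \<beta> \<in> Field r \<Longrightarrow> g (Some \<beta>) = \<iota> (f \<beta>)"
    using conv by (auto simp: seq_converges_def)
  have f_Ter: "f \<beta> \<in> Ter (sig R)" if "\<beta> \<in> Field r" for \<beta>
    using f that continuous_map_image_subset_topspace[of "ord_topology r" "ter_topology (sig R)" f]
    by (auto simp: reduction_seq_def topspace_ord_topology)
  have "closedin (ter_topology (sig S)) (\<iota> ` topspace (ter_topology (sig R)))"
    using ter.closedin_image src.fin.mcomplete_completion by simp
  moreover have "g ` Some ` Field r \<subseteq> \<iota> ` topspace (ter_topology (sig R))"
    using gf f_Ter by auto
  ultimately obtain h where h: "continuous_map (ord_topology (ord_succ r)) (ter_topology (sig R)) h"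
    and \<iota>h: "\<And>x. x \<in> topspace (ord_topology (ord_succ r)) \<Longrightarrow> \<iota> (h x) = g x"
    using closed_embedding_lift[OF ter.embedding _ g dense_in_ord_succ[OF r]] by blast
  have "h ` topspace (ord_topology (ord_succ r)) \<subseteq> Ter (sig R)"
    using continuous_map_image_subset_topspace[OF h] by simp
  then have "h (Some \<beta>) = f \<beta>" if "\<beta> \<in> Field r" for \<beta>
    using \<iota>h[of "Some \<beta>"] gf f_Ter that
    by (intro inj_onD[OF ter.inj_on_space]) (auto simp: topspace_ord_topology Field_ord_succ)
  then show ?thesis
    using h unfolding seq_converges_def by blast
qed

lemma itrs_convergent_reflect:
  assumes "itrs_convergent TYPE('i) S"
  shows "itrs_convergent TYPE('i) R"
  using assms reduction_seq_embed seq_converges_reflect unfolding itrs_convergent_def by blast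

end

section \<open>Indirection\<close>

lemma continuous_umm_identity: "continuous_umm 1 (\<lambda>x. x 0)"
proof -
  have "continuous_map (product_topology (\<lambda>_. top_of_set {0..1}) {..<1 :: nat}) (top_of_set {0..1})
          (\<lambda>x. x 0 :: real)"
    by (rule continuous_map_product_projection) simp
  then show ?thesis
    by (auto simp: continuous_umm_def umm_def PiE_iff)
qed

lemma term_space_indirect: "term_space \<Sigma> \<Longrightarrow> term_space (indirect_sig \<Sigma>)"
  using continuous_umm_identity by (auto simp: term_space_def term_metric_def indirect_sig_def)

lemma sig_embedding_Some: "term_space \<Sigma> \<Longrightarrow> sig_embedding \<Sigma> (indirect_sig \<Sigma>) Some"
  using term_space_indirect[of \<Sigma>]
  by (auto simp: sig_embedding_def sig_embedding_axioms_def indirect_sig_def)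

lemma (in sig_embedding) sig_embedding_indirect:
  "sig_embedding (indirect_sig \<Sigma>) (indirect_sig \<Delta>) (map_option \<phi>)"
  using inj symbol arity_eq umap_eq term_space_indirect[OF src.term_space_axioms]
    term_space_indirect[OF tgt.term_space_axioms]
  by (auto simp: sig_embedding_def sig_embedding_axioms_def indirect_sig_def inj_on_def)

lemma sig_indirected: "sig (indirected R) = indirect_sig (sig R)"
  by (simp add: indirected_def Let_def)

lemma rules_indirectedE:
  assumes "(l, r) \<in> rules (indirected R)"
  obtains (rule) l' r' where "(l', r') \<in> rules R"
      "l = ter_embed (indirect_sig (sig R)) Some l'"
      "r = ter_app (indirect_sig (sig R)) None [ter_embed (indirect_sig (sig R)) Some r']"
    | (drop_I) x where "l = ter_app (indirect_sig (sig R)) None [ter_var (indirect_sig (sig R)) x]"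
      "r = ter_var (indirect_sig (sig R)) x"
  using assms by (auto simp: indirected_def Let_def)

lemma rules_indirectedI:
  "(l, r) \<in> rules R \<Longrightarrow>
    (ter_embed (indirect_sig (sig R)) Some l,
     ter_app (indirect_sig (sig R)) None [ter_embed (indirect_sig (sig R)) Some r])
      \<in> rules (indirected R)"
  "(ter_app (indirect_sig (sig R)) None [ter_var (indirect_sig (sig R)) x],
    ter_var (indirect_sig (sig R)) x) \<in> rules (indirected R)"
  by (auto simp: indirected_def Let_def)

lemma (in itrs_embedding) itrs_embedding_indirected:
  "itrs_embedding (indirected R) (indirected S) (map_option \<phi>)"
proof -
  let ?\<Sigma> = "indirect_sig (sig R)" and ?\<Delta> = "indirect_sig (sig S)"
  interpret I: sig_embedding ?\<Sigma> ?\<Delta> "map_option \<phi>" "TYPE('v)"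
    by (rule sig_embedding_indirect)
  interpret incl: sig_embedding "sig R" ?\<Sigma> Some "TYPE('v)"
    by (rule sig_embedding_Some) (rule src.term_space_axioms)
  have embed_Some: "I.\<iota> (ter_embed ?\<Sigma> Some c) = ter_embed ?\<Delta> Some (\<iota> c)"
    if "c \<in> Ter (sig R)" for c
    using ter_embed_comp[OF incl.sig_embedding_axioms sig_embedding_indirect that]
      ter_embed_comp[OF sig_embedding_axioms sig_embedding_Some[OF tgt.term_space_axioms] that]
    by (simp add: o_def)
  have app_I: "ter_app ?\<Sigma> None [c] \<in> Ter ?\<Sigma>"
    "I.\<iota> (ter_app ?\<Sigma> None [c]) = ter_app ?\<Delta> None [I.\<iota> c]" if "c \<in> Ter ?\<Sigma>" for c
    using that I.src.ter_app_in_Ter[of None "[c]"] I.ter_embed_app[of None "[c]"]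
    by (simp_all add: indirect_sig_def)
  have "(l \<in> Ter ?\<Sigma> \<and> r \<in> Ter ?\<Sigma>) \<and> (I.\<iota> l, I.\<iota> r) \<in> rules (indirected S)"
    if "(l, r) \<in> rules (indirected R)" for l r
    using that
  proof (cases rule: rules_indirectedE)
    case (rule l' r')
    then show ?thesis
      using rules_in_Ter[of l' r'] rules_embed rules_indirectedI(1)[of "\<iota> l'" "\<iota> r'" S]
      by (simp add: app_I embed_Some incl.ter.maps_to)
  next
    case (drop_I x)
    then show ?thesis
      using rules_indirectedI(2)[of S x] by (simp add: app_I I.ter_embed_var I.src.ter_var_in_Ter)
  qed
  then show ?thesis
    using I.sig_embedding_axioms
    by (auto simp: itrs_embedding_def itrs_embedding_axioms_def sig_indirected)
qed

lemma (in itrs_embedding) strongly_convergent_reflect: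
  assumes "strongly_convergent TYPE('i) S"
  shows "strongly_convergent TYPE('i) R"
  using assms itrs_embedding.itrs_convergent_reflect[OF itrs_embedding_indirected]
  by (simp add: strongly_convergent_def)

section \<open>Disjoint unions\<close>

lemma term_space_union: "term_space \<Sigma> \<Longrightarrow> term_space \<Delta> \<Longrightarrow> term_space (sig_union \<Sigma> \<Delta>)"
  by (auto simp: term_space_def term_metric_def sig_union_def)

lemma sig_embedding_union:
  assumes "term_space \<Sigma>" "term_space \<Delta>"
  shows "sig_embedding \<Sigma> (sig_union \<Sigma> \<Delta>) id"
    and "disjoint_sigs \<Sigma> \<Delta> \<Longrightarrow> sig_embedding \<Delta> (sig_union \<Sigma> \<Delta>) id"
  using assms term_space_union[OF assms]
  by (auto simp: sig_embedding_def sig_embedding_axioms_def sig_union_def disjoint_sigs_def)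

lemma itrs_embedding_union:
  assumes R: "is_itrs R" and S: "is_itrs S"
  shows "itrs_embedding R (itrs_union R S) id"
    and "disjoint_sigs (sig R) (sig S) \<Longrightarrow> itrs_embedding S (itrs_union R S) id"
proof -
  have "term_space (sig R)" "term_space (sig S)"
    using R S by (auto simp: is_itrs_def term_space_def)
  note embedding = sig_embedding_union[OF this]
  have sig: "sig (itrs_union R S) = sig_union (sig R) (sig S)"
    by (simp add: itrs_union_def Let_def)
  show "itrs_embedding R (itrs_union R S) id"
    using R embedding(1) unfolding itrs_embedding_def itrs_embedding_axioms_def sig
    by (force simp: is_itrs_def itrs_union_def Let_def)
  show "itrs_embedding S (itrs_union R S) id" if "disjoint_sigs (sig R) (sig S)"
    using S embedding(2)[OF that] unfolding itrs_embedding_def itrs_embedding_axioms_def sig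
    by (force simp: is_itrs_def itrs_union_def Let_def)
qed

theorem theorem7p2:
  fixes R S :: "('f, 'v) itrs"
  assumes "is_itrs R" and "is_itrs S"
    and "disjoint_sigs (sig R) (sig S)"
  shows "(itrs_convergent TYPE('i) (itrs_union R S) \<longrightarrow>
            itrs_convergent TYPE('i) R \<and> itrs_convergent TYPE('i) S) \<and>
         (strongly_convergent TYPE('i) (itrs_union R S) \<longrightarrow>
            strongly_convergent TYPE('i) R \<and> strongly_convergent TYPE('i) S)"
proof -
  interpret R: itrs_embedding R "itrs_union R S" id
    using assms by (intro itrs_embedding_union)
  interpret S: itrs_embedding S "itrs_union R S" id
    using assms by (intro itrs_embedding_union)
  show ?thesis
    using R.itrs_convergent_reflect S.itrs_convergent_reflect
      R.strongly_convergent_reflect S.strongly_convergent_reflect by blast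
qed

end
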